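(* The category $\mathcal{C}_{TCM}$ of topos causal models is an elementary topos, i.e. it has all (small) limits, all (small) colimits, exponential objects, and a subobject classifier.
   Context: Category $\mathcal{C}_{TCM}$. An object is a triple $\langle U, V, F\rangle$, where $U$ is the set of (realizations of) the exogenous variables, $V$ is the set of (realizations of) the endogenous variables, and $F: U \to V$ is a function; thus an object is abstractly just a function of sets $F: U\to V$. A morphism from $f: U\to V$ to $f': U'\to V'$ is a pair of functions $\langle h, g\rangle$ with $h: U\to U'$ and $g: V\to V'$ such that $g\circ f = f'\circ h$. Composition and identities are componentwise. Elementary topos (the paper's definition): a category that has all limits, all colimits, exponential objects, and a subobject classifier. Exponential objects: for every object $x$, the functor $x\times -$ has a right adjoint $(-)^x$. Subobject classifier: an object $\Omega$ and an arrow $\mathbf{true}: \mathbf{1}\to\Omega$ from the terminal object such that for every monic arrow $m: S\to X$ there is a unique arrow $\phi: X\to\Omega$ for which the square with sides $m: S\to X$, $S\to\mathbf{1}$, $\mathbf{true}:\mathbf{1}\to\Omega$ and $\phi: X\to\Omega$ is a pullback. *)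

theory Defs
  imports "HOL-Library.FuncSet" "HOL-Library.Equipollence"
begin

section \<open>Universes of small sets\<close>

text \<open>
  HOL has no type of all sets, so the size convention of category theory is made relative to
  a type \<open>'u\<close> that plays the role of a Grothendieck universe. Take \<open>'u\<close> to be
  the universe \<open>V\<^sub>\<kappa>\<close> itself: since \<open>V\<^sub>\<kappa>\<close> has cardinality
  \<open>\<kappa>\<close>, its elements are exactly its subsets of cardinality below its own.
  These are the small sets. \<open>universe\<close> says that \<open>'u\<close> has strong
  limit and regular cardinality (which forces it to be infinite), that is, \<open>\<kappa>\<close>
  is \<open>\<omega>\<close> or strongly inaccessible.
\<close>

definition small :: "'u set \<Rightarrow> bool" where
  "small A \<longleftrightarrow> A \<prec> (UNIV :: 'u set)"

definition universe :: "'u itself \<Rightarrow> bool" where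
  "universe u \<longleftrightarrow>
     (\<forall>A :: 'u set. small A \<longrightarrow> Pow A \<prec> (UNIV :: 'u set)) \<and>
     (\<forall>(I :: 'u set) (B :: 'u \<Rightarrow> 'u set).
        small I \<longrightarrow> (\<forall>i\<in>I. small (B i)) \<longrightarrow> small (\<Union>i\<in>I. B i))"

text \<open>The smallest universe: hereditarily finite sets, coded by natural numbers.\<close>

lemma small_nat_iff: "small (A :: nat set) \<longleftrightarrow> finite A"
proof
  assume "small A"
  then show "finite A"
    unfolding small_def lesspoll_def eqpoll_def
    by (meson bij_betw_from_nat_into bij_betw_inv countable_infiniteE' countableI_type
        to_nat_on_infinite)
next
  assume "finite A"
  then show "small A"
    by (simp add: small_def finite_lesspoll_infinite)
qed

lemma universe_nat: "universe TYPE(nat)"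
  unfolding universe_def small_nat_iff
  by (auto intro: finite_lesspoll_infinite)


section \<open>Categories, functors, adjunctions\<close>

record ('o, 'a) cat =
  Obj :: "'o set"
  Arr :: "'a set"
  Dom :: "'a \<Rightarrow> 'o"
  Cod :: "'a \<Rightarrow> 'o"
  Id :: "'o \<Rightarrow> 'a"
  Comp :: "'a \<Rightarrow> 'a \<Rightarrow> 'a"

text \<open>\<open>Comp C g f\<close> is the composite \<open>g \<circ> f\<close>; it is only meaningful when
  \<open>Dom C g = Cod C f\<close>.\<close>

definition Hom :: "('o, 'a) cat \<Rightarrow> 'o \<Rightarrow> 'o \<Rightarrow> 'a set" where
  "Hom C x y = {f \<in> Arr C. Dom C f = x \<and> Cod C f = y}"

locale category =
  fixes C :: "('o, 'a) cat"
  assumes Dom_in_Obj: "f \<in> Arr C \<Longrightarrow> Dom C f \<in> Obj C"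
    and Cod_in_Obj: "f \<in> Arr C \<Longrightarrow> Cod C f \<in> Obj C"
    and Id_in_Hom: "x \<in> Obj C \<Longrightarrow> Id C x \<in> Hom C x x"
    and Comp_in_Hom: "f \<in> Hom C x y \<Longrightarrow> g \<in> Hom C y z \<Longrightarrow> Comp C g f \<in> Hom C x z"
    and Comp_Id: "f \<in> Hom C x y \<Longrightarrow> Comp C f (Id C x) = f"
    and Id_Comp: "f \<in> Hom C x y \<Longrightarrow> Comp C (Id C y) f = f"
    and Comp_assoc: "f \<in> Hom C w x \<Longrightarrow> g \<in> Hom C x y \<Longrightarrow> h \<in> Hom C y z \<Longrightarrow>
      Comp C h (Comp C g f) = Comp C (Comp C h g) f"

record ('o, 'a, 'p, 'b) cat_map =
  ObjMap :: "'o \<Rightarrow> 'p"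
  ArrMap :: "'a \<Rightarrow> 'b"

definition is_functor :: "('o, 'a) cat \<Rightarrow> ('p, 'b) cat \<Rightarrow> ('o, 'a, 'p, 'b) cat_map \<Rightarrow> bool" where
  "is_functor C D F \<longleftrightarrow>
     category C \<and> category D \<and>
     (\<forall>x\<in>Obj C. ObjMap F x \<in> Obj D) \<and>
     (\<forall>x y. \<forall>f\<in>Hom C x y. ArrMap F f \<in> Hom D (ObjMap F x) (ObjMap F y)) \<and>
     (\<forall>x\<in>Obj C. ArrMap F (Id C x) = Id D (ObjMap F x)) \<and>
     (\<forall>x y z. \<forall>f\<in>Hom C x y. \<forall>g\<in>Hom C y z.
        ArrMap F (Comp C g f) = Comp D (ArrMap F g) (ArrMap F f))"

text \<open>\<open>\<phi> c d\<close> is the bijection from \<open>Hom D (L c) d\<close> to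
  \<open>Hom C c (R d)\<close>, natural in \<open>c\<close> and \<open>d\<close>.\<close>

definition is_adjunction ::
  "('o, 'a) cat \<Rightarrow> ('p, 'b) cat \<Rightarrow> ('o, 'a, 'p, 'b) cat_map \<Rightarrow> ('p, 'b, 'o, 'a) cat_map \<Rightarrow>
   ('o \<Rightarrow> 'p \<Rightarrow> 'b \<Rightarrow> 'a) \<Rightarrow> bool" where
  "is_adjunction C D L R \<phi> \<longleftrightarrow>
     is_functor C D L \<and> is_functor D C R \<and>
     (\<forall>c\<in>Obj C. \<forall>d\<in>Obj D. bij_betw (\<phi> c d) (Hom D (ObjMap L c) d) (Hom C c (ObjMap R d))) \<and>
     (\<forall>c' c d d'. \<forall>u\<in>Hom C c' c. \<forall>v\<in>Hom D d d'. \<forall>f\<in>Hom D (ObjMap L c) d.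
        \<phi> c' d' (Comp D v (Comp D f (ArrMap L u))) =
        Comp C (ArrMap R v) (Comp C (\<phi> c d f) u))"

definition has_right_adjoint ::
  "('o, 'a) cat \<Rightarrow> ('p, 'b) cat \<Rightarrow> ('o, 'a, 'p, 'b) cat_map \<Rightarrow> bool" where
  "has_right_adjoint C D L \<longleftrightarrow> (\<exists>R \<phi>. is_adjunction C D L R \<phi>)"


section \<open>Limits and colimits\<close>

definition is_cone ::
  "('i, 'j) cat \<Rightarrow> ('o, 'a) cat \<Rightarrow> ('i, 'j, 'o, 'a) cat_map \<Rightarrow> 'o \<Rightarrow> ('i \<Rightarrow> 'a) \<Rightarrow> bool" where
  "is_cone J C D x \<pi> \<longleftrightarrow>
     x \<in> Obj C \<and> (\<forall>i\<in>Obj J. \<pi> i \<in> Hom C x (ObjMap D i)) \<and>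
     (\<forall>i j. \<forall>k\<in>Hom J i j. Comp C (ArrMap D k) (\<pi> i) = \<pi> j)"

definition is_limit ::
  "('i, 'j) cat \<Rightarrow> ('o, 'a) cat \<Rightarrow> ('i, 'j, 'o, 'a) cat_map \<Rightarrow> 'o \<Rightarrow> ('i \<Rightarrow> 'a) \<Rightarrow> bool" where
  "is_limit J C D x \<pi> \<longleftrightarrow>
     is_cone J C D x \<pi> \<and>
     (\<forall>y \<rho>. is_cone J C D y \<rho> \<longrightarrow>
        (\<exists>!f. f \<in> Hom C y x \<and> (\<forall>i\<in>Obj J. Comp C (\<pi> i) f = \<rho> i)))"

definition is_cocone ::
  "('i, 'j) cat \<Rightarrow> ('o, 'a) cat \<Rightarrow> ('i, 'j, 'o, 'a) cat_map \<Rightarrow> 'o \<Rightarrow> ('i \<Rightarrow> 'a) \<Rightarrow> bool" where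
  "is_cocone J C D x \<iota> \<longleftrightarrow>
     x \<in> Obj C \<and> (\<forall>i\<in>Obj J. \<iota> i \<in> Hom C (ObjMap D i) x) \<and>
     (\<forall>i j. \<forall>k\<in>Hom J i j. Comp C (\<iota> j) (ArrMap D k) = \<iota> i)"

definition is_colimit ::
  "('i, 'j) cat \<Rightarrow> ('o, 'a) cat \<Rightarrow> ('i, 'j, 'o, 'a) cat_map \<Rightarrow> 'o \<Rightarrow> ('i \<Rightarrow> 'a) \<Rightarrow> bool" where
  "is_colimit J C D x \<iota> \<longleftrightarrow>
     is_cocone J C D x \<iota> \<and>
     (\<forall>y \<rho>. is_cocone J C D y \<rho> \<longrightarrow>
        (\<exists>!f. f \<in> Hom C x y \<and> (\<forall>i\<in>Obj J. Comp C f (\<iota> i) = \<rho> i)))"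

text \<open>A small category has small sets of objects and of arrows; up to isomorphism both may
  be taken to be subsets of the universe.\<close>

definition small_category :: "('u, 'u) cat \<Rightarrow> bool" where
  "small_category J \<longleftrightarrow> category J \<and> small (Obj J) \<and> small (Arr J)"

definition has_small_limits :: "'u itself \<Rightarrow> ('o, 'a) cat \<Rightarrow> bool" where
  "has_small_limits u C \<longleftrightarrow>
     (\<forall>(J :: ('u, 'u) cat) D. small_category J \<and> is_functor J C D \<longrightarrow> (\<exists>x \<pi>. is_limit J C D x \<pi>))"

definition has_small_colimits :: "'u itself \<Rightarrow> ('o, 'a) cat \<Rightarrow> bool" where
  "has_small_colimits u C \<longleftrightarrow>
     (\<forall>(J :: ('u, 'u) cat) D. small_category J \<and> is_functor J C D \<longrightarrow> (\<exists>x \<iota>. is_colimit J C D x \<iota>))"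

definition is_terminal :: "('o, 'a) cat \<Rightarrow> 'o \<Rightarrow> bool" where
  "is_terminal C t \<longleftrightarrow> t \<in> Obj C \<and> (\<forall>x\<in>Obj C. \<exists>!f. f \<in> Hom C x t)"

definition is_product :: "('o, 'a) cat \<Rightarrow> 'o \<Rightarrow> 'o \<Rightarrow> 'o \<Rightarrow> 'a \<Rightarrow> 'a \<Rightarrow> bool" where
  "is_product C x y p \<pi>1 \<pi>2 \<longleftrightarrow>
     p \<in> Obj C \<and> \<pi>1 \<in> Hom C p x \<and> \<pi>2 \<in> Hom C p y \<and>
     (\<forall>w. \<forall>f\<in>Hom C w x. \<forall>g\<in>Hom C w y.
        \<exists>!h. h \<in> Hom C w p \<and> Comp C \<pi>1 h = f \<and> Comp C \<pi>2 h = g)"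

text \<open>The square has top \<open>p\<close>, left \<open>q\<close>, right \<open>f\<close> and bottom \<open>g\<close>.\<close>

definition is_pullback :: "('o, 'a) cat \<Rightarrow> 'a \<Rightarrow> 'a \<Rightarrow> 'a \<Rightarrow> 'a \<Rightarrow> bool" where
  "is_pullback C f g p q \<longleftrightarrow>
     f \<in> Arr C \<and> g \<in> Arr C \<and> p \<in> Arr C \<and> q \<in> Arr C \<and>
     Cod C f = Cod C g \<and> Dom C p = Dom C q \<and> Cod C p = Dom C f \<and> Cod C q = Dom C g \<and>
     Comp C f p = Comp C g q \<and>
     (\<forall>w. \<forall>a\<in>Hom C w (Dom C f). \<forall>b\<in>Hom C w (Dom C g). Comp C f a = Comp C g b \<longrightarrow>
        (\<exists>!h. h \<in> Hom C w (Dom C p) \<and> Comp C p h = a \<and> Comp C q h = b))"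


section \<open>Elementary toposes\<close>

text \<open>\<open>T\<close> is the functor \<open>x \<times> -\<close> for the choice of product
  projections \<open>\<pi>1 y\<close> and \<open>\<pi>2 y\<close> from \<open>x \<times> y\<close>; on arrows it is
  \<open>id\<^sub>x \<times> f\<close>.\<close>

definition is_times_functor ::
  "('o, 'a) cat \<Rightarrow> 'o \<Rightarrow> ('o, 'a, 'o, 'a) cat_map \<Rightarrow> ('o \<Rightarrow> 'a) \<Rightarrow> ('o \<Rightarrow> 'a) \<Rightarrow> bool" where
  "is_times_functor C x T \<pi>1 \<pi>2 \<longleftrightarrow>
     is_functor C C T \<and>
     (\<forall>y\<in>Obj C. is_product C x y (ObjMap T y) (\<pi>1 y) (\<pi>2 y)) \<and>
     (\<forall>y z. \<forall>f\<in>Hom C y z.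
        Comp C (\<pi>1 z) (ArrMap T f) = \<pi>1 y \<and>
        Comp C (\<pi>2 z) (ArrMap T f) = Comp C f (\<pi>2 y))"

definition has_exponentials :: "('o, 'a) cat \<Rightarrow> bool" where
  "has_exponentials C \<longleftrightarrow>
     (\<forall>x\<in>Obj C. \<exists>T \<pi>1 \<pi>2. is_times_functor C x T \<pi>1 \<pi>2 \<and> has_right_adjoint C C T)"

definition is_monic :: "('o, 'a) cat \<Rightarrow> 'a \<Rightarrow> bool" where
  "is_monic C m \<longleftrightarrow>
     m \<in> Arr C \<and>
     (\<forall>w. \<forall>f\<in>Hom C w (Dom C m). \<forall>g\<in>Hom C w (Dom C m). Comp C m f = Comp C m g \<longrightarrow> f = g)"

text \<open>\<open>b\<close> ranges over the unique arrow from \<open>S\<close> to the terminal object.\<close>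

definition is_subobject_classifier :: "('o, 'a) cat \<Rightarrow> 'o \<Rightarrow> 'o \<Rightarrow> 'a \<Rightarrow> bool" where
  "is_subobject_classifier C \<Omega> t tru \<longleftrightarrow>
     \<Omega> \<in> Obj C \<and> is_terminal C t \<and> tru \<in> Hom C t \<Omega> \<and>
     (\<forall>S X. \<forall>m\<in>Hom C S X. \<forall>b\<in>Hom C S t. is_monic C m \<longrightarrow>
        (\<exists>!\<phi>. \<phi> \<in> Hom C X \<Omega> \<and> is_pullback C \<phi> tru m b))"

definition has_subobject_classifier :: "('o, 'a) cat \<Rightarrow> bool" where
  "has_subobject_classifier C \<longleftrightarrow> (\<exists>\<Omega> t tru. is_subobject_classifier C \<Omega> t tru)"

definition elementary_topos :: "'u itself \<Rightarrow> ('o, 'a) cat \<Rightarrow> bool" where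
  "elementary_topos u C \<longleftrightarrow>
     category C \<and> has_small_limits u C \<and> has_small_colimits u C \<and>
     has_exponentials C \<and> has_subobject_classifier C"


section \<open>Topos causal models\<close>

record 'u tcm =
  Exo :: "'u set"
  Endo :: "'u set"
  Mech :: "'u \<Rightarrow> 'u"

definition is_tcm :: "'u tcm \<Rightarrow> bool" where
  "is_tcm M \<longleftrightarrow> small (Exo M) \<and> small (Endo M) \<and> Mech M \<in> Exo M \<rightarrow>\<^sub>E Endo M"

record 'u tcm_arrow =
  Source :: "'u tcm"
  Target :: "'u tcm"
  ExoMap :: "'u \<Rightarrow> 'u"
  EndoMap :: "'u \<Rightarrow> 'u"

text \<open>All maps are extensional, so that equality of models and of arrows is equality of the
  underlying set-theoretic functions.\<close>

definition is_tcm_arrow :: "'u tcm_arrow \<Rightarrow> bool" where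
  "is_tcm_arrow a \<longleftrightarrow>
     is_tcm (Source a) \<and> is_tcm (Target a) \<and>
     ExoMap a \<in> Exo (Source a) \<rightarrow>\<^sub>E Exo (Target a) \<and>
     EndoMap a \<in> Endo (Source a) \<rightarrow>\<^sub>E Endo (Target a) \<and>
     compose (Exo (Source a)) (EndoMap a) (Mech (Source a)) =
     compose (Exo (Source a)) (Mech (Target a)) (ExoMap a)"

definition TCM :: "('u tcm, 'u tcm_arrow) cat" where
  "TCM = \<lparr>
     Obj = {M. is_tcm M},
     Arr = {a. is_tcm_arrow a},
     Dom = Source,
     Cod = Target,
     Id = (\<lambda>M. \<lparr>Source = M, Target = M,
                 ExoMap = restrict id (Exo M), EndoMap = restrict id (Endo M)\<rparr>),
     Comp = (\<lambda>b a. \<lparr>Source = Source a, Target = Target b,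
                   ExoMap = compose (Exo (Source a)) (ExoMap b) (ExoMap a),
                   EndoMap = compose (Endo (Source a)) (EndoMap b) (EndoMap a)\<rparr>)\<rparr>"

end

(* A causal model is a functor from the arrow category 0 -> 1 to small sets, so everything is
   computed pointwise or as for presheaves. Limits and colimits of the exogenous and of the
   endogenous parts are formed separately, and the mechanisms induce the map between them.
   Exponentials are universal arrows out of the product functors. Monic arrows are componentwise
   injective, and a square over an arrow from the terminal model is a pullback exactly when the
   two fibres over it are the two images. *)
theory Submission
  imports Defs
begin

text \<open>The carriers of a model must be subsets of \<open>'u\<close>, whereas limits consist of
  families, colimits of classes of pairs and exponentials of functions, all of other types. Each
  such set is built where it naturally lives, bounded in cardinality by the strong limit and
  regularity clauses of \<open>universe\<close>, and then moved into \<open>'u\<close> by an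
  injective coding. The shape of the exponential and of the classifier is dictated by the Yoneda
  lemma. The representable functors are \<open>exo_point\<close> and \<open>endo_point\<close>. An
  exogenous element of the exponential of N by M is therefore an arrow from the product of
  \<open>exo_point\<close> and M to N, that is, an arrow from M to N. An endogenous one is an arrow
  out of the product of \<open>endo_point\<close> and M, which has no exogenous part. Likewise the
  truth values are the submodels of the representables: \<open>exo_point\<close> has three (empty,
  the endogenous point alone, everything) and \<open>endo_point\<close> has two. The mechanism of
  the classifier keeps the endogenous part of a submodel, so the middle value goes to truth.\<close>

section \<open>Closure properties of small sets\<close>

text \<open>With n elements, n > 0 since types are inhabited, removing one point leaves a small set,
  so the strong limit clause gives 2^(n-1) < n. This contradicts n - 1 < 2^(n-1).\<close>

lemma universe_infinite:
  assumes "universe TYPE('u)"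
  shows "infinite (UNIV :: 'u set)"
proof
  assume fin: "finite (UNIV :: 'u set)"
  let ?U = "UNIV :: 'u set" and ?A = "UNIV - {undefined :: 'u}"
  have card_A: "card ?A = card ?U - 1"
    using fin by simp
  have pos: "0 < card ?U"
    using fin by (simp add: finite_UNIV_card_ge_0)
  have finA: "finite ?A"
    using fin by (rule finite_subset[OF subset_UNIV])
  have "\<not> ?A \<approx> ?U"
    using card_A pos finA fin by (simp add: eqpoll_iff_card)
  then have "small ?A"
    unfolding small_def lesspoll_def by (simp add: subset_imp_lepoll)
  then have "Pow ?A \<lesssim> ?U"
    using assms unfolding universe_def by (blast intro: lesspoll_imp_lepoll)
  then have "2 ^ card ?A \<le> card ?U"
    using fin finA by (simp add: lepoll_iff_card_le card_Pow)
  moreover have "\<not> Pow ?A \<approx> ?U"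
    using assms \<open>small ?A\<close> unfolding universe_def lesspoll_def by blast
  then have "2 ^ card ?A \<noteq> card ?U"
    using fin finA by (simp add: eqpoll_iff_card card_Pow)
  moreover have "card ?A < 2 ^ card ?A"
    by simp
  ultimately show False
    using card_A pos by linarith
qed

text \<open>This moves a set of functions or of classes into \<open>'u\<close>: \<open>enc\<close>
  is the injection behind \<open>\<prec>\<close> and \<open>dec\<close> its inverse on
  \<open>A\<close>.\<close>

lemma small_code:
  assumes "(A :: 'b set) \<prec> (UNIV :: 'u set)"
  shows "\<exists>(enc :: 'b \<Rightarrow> 'u) dec. small (enc ` A) \<and> (\<forall>a\<in>A. dec (enc a) = a)"
proof -
  obtain enc :: "'b \<Rightarrow> 'u" where enc: "inj_on enc A"
    using assms unfolding lesspoll_def lepoll_def by blast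
  show ?thesis
  proof (intro exI conjI ballI)
    show "small (enc ` A)"
      unfolding small_def using assms by (rule lesspoll_trans1[OF image_lepoll])
    show "the_inv_into A enc (enc a) = a" if "a \<in> A" for a
      using enc that by (simp add: the_inv_into_f_f)
  qed
qed

lemma small_finite:
  assumes "universe TYPE('u)" "finite (A :: 'u set)"
  shows "small A"
  unfolding small_def using assms universe_infinite finite_lesspoll_infinite by blast

text \<open>An infinite cardinal equals its square. The coded pairs serve both disjoint unions and
  binary products of models.\<close>

lemma universe_pairing:
  assumes "universe TYPE('u)"
  obtains pr :: "'u \<times> 'u \<Rightarrow> 'u" where "inj pr"
proof -
  have "ordIso2 (card_of ((UNIV :: 'u set) \<times> (UNIV :: 'u set))) (card_of (UNIV :: 'u set))"
    using card_of_Times_same_infinite universe_infinite[OF assms] by blast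
  then obtain pr :: "'u \<times> 'u \<Rightarrow> 'u" where "bij_betw pr (UNIV \<times> UNIV) UNIV"
    unfolding card_of_ordIso[symmetric] by blast
  then show thesis
    using that by (auto dest: bij_betw_imp_inj_on)
qed

text \<open>Coding pairs turns the disjoint union into a union of small subsets of \<open>'u\<close>
  over a small index set, where the regularity clause of \<open>universe\<close> applies.\<close>

lemma Sigma_lesspoll_universe:
  fixes X :: "'u \<Rightarrow> 'u set"
  assumes u: "universe TYPE('u)" and "small I" "\<And>i. i \<in> I \<Longrightarrow> small (X i)"
  shows "Sigma I X \<prec> (UNIV :: 'u set)"
proof -
  obtain pr :: "'u \<times> 'u \<Rightarrow> 'u" where pr: "inj pr"
    using universe_pairing[OF u] .
  have "small ((\<lambda>a. pr (i, a)) ` X i)" if "i \<in> I" for i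
    using assms(3)[OF that] unfolding small_def by (rule lesspoll_trans1[OF image_lepoll])
  then have "small (\<Union>i\<in>I. (\<lambda>a. pr (i, a)) ` X i)"
    by (rule u[unfolded universe_def, THEN conjunct2, rule_format, OF \<open>small I\<close>])
  also have "(\<Union>i\<in>I. (\<lambda>a. pr (i, a)) ` X i) = pr ` Sigma I X"
    by auto
  finally have "pr ` Sigma I X \<prec> (UNIV :: 'u set)"
    unfolding small_def .
  moreover have "Sigma I X \<approx> pr ` Sigma I X"
    using pr by (meson eqpoll_sym inj_on_image_eqpoll_self inj_on_subset subset_UNIV)
  ultimately show ?thesis
    by (rule eq_lesspoll_trans[rotated])
qed

text \<open>The strong limit clause speaks of subsets of \<open>'u\<close> only; taking images under
  a coding carries it over to a set of any type.\<close>

lemma Pow_lesspoll_universe: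
  assumes u: "universe TYPE('u)" and A: "(A :: 'b set) \<prec> (UNIV :: 'u set)"
  shows "Pow A \<prec> (UNIV :: 'u set)"
proof -
  obtain enc :: "'b \<Rightarrow> 'u" and dec where
    enc: "small (enc ` A)" "\<And>a. a \<in> A \<Longrightarrow> dec (enc a) = a"
    using small_code[OF A] by blast
  have "Pow A \<lesssim> Pow (enc ` A)"
  proof (rule lepoll_def[THEN meta_eq_to_obj_eq, THEN iffD2], intro exI conjI)
    show "inj_on ((`) enc) (Pow A)"
      using enc(2) by (intro inj_on_image_Pow inj_on_inverseI)
  qed auto
  also have "Pow (enc ` A) \<prec> (UNIV :: 'u set)"
    using u enc(1) unfolding universe_def by blast
  finally show ?thesis .
qed

text \<open>An extensional family is determined by its graph, a subset of \<open>Sigma I X\<close>,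
  so the product is no larger than a power set already bounded.\<close>

lemma PiE_lesspoll_universe:
  fixes X :: "'u \<Rightarrow> 'u set"
  assumes "universe TYPE('u)" "small I" "\<And>i. i \<in> I \<Longrightarrow> small (X i)"
  shows "PiE I X \<prec> (UNIV :: 'u set)"
proof -
  have "inj_on (\<lambda>x. (\<lambda>i. (i, x i)) ` I) (PiE I X)"
  proof (rule inj_onI)
    fix x y
    assume x: "x \<in> PiE I X" and y: "y \<in> PiE I X"
      and eq: "(\<lambda>i. (i, x i)) ` I = (\<lambda>i. (i, y i)) ` I"
    have "x i = y i" if "i \<in> I" for i
    proof -
      have "(i, x i) \<in> (\<lambda>i. (i, y i)) ` I"
        using that unfolding eq[symmetric] by blast
      then show ?thesis by blast
    qed
    with x y show "x = y"
      by (rule PiE_ext)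
  qed
  moreover have "(\<lambda>x. (\<lambda>i. (i, x i)) ` I) ` PiE I X \<subseteq> Pow (Sigma I X)"
    by (auto dest: PiE_mem)
  ultimately have "PiE I X \<lesssim> Pow (Sigma I X)"
    unfolding lepoll_def by blast
  also have "Pow (Sigma I X) \<prec> (UNIV :: 'u set)"
    by (rule Pow_lesspoll_universe[OF assms(1) Sigma_lesspoll_universe[OF assms]])
  finally show ?thesis .
qed

text \<open>The factors may have any type, as is required for the pairs of maps in an exponential;
  both are coded into \<open>'u\<close> to fall back on \<open>Sigma\<close>.\<close>

lemma Times_lesspoll_universe:
  fixes A :: "'b set" and B :: "'c set"
  assumes u: "universe TYPE('u)" and A: "A \<prec> (UNIV :: 'u set)" and B: "B \<prec> (UNIV :: 'u set)"
  shows "A \<times> B \<prec> (UNIV :: 'u set)"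
proof -
  obtain f :: "'b \<Rightarrow> 'u" and f' where f: "small (f ` A)" "\<And>a. a \<in> A \<Longrightarrow> f' (f a) = a"
    using small_code[OF A] by blast
  obtain g :: "'c \<Rightarrow> 'u" and g' where g: "small (g ` B)" "\<And>b. b \<in> B \<Longrightarrow> g' (g b) = b"
    using small_code[OF B] by blast
  have "inj_on f A" "inj_on g B"
    using f(2) g(2) by (auto intro: inj_on_inverseI)
  then have "A \<times> B \<lesssim> (f ` A) \<times> (g ` B)"
    by (intro times_lepoll_mono) simp_all
  also have "\<dots> \<prec> (UNIV :: 'u set)"
    using u f(1) g(1) by (intro Sigma_lesspoll_universe)
  finally show ?thesis .
qed


section \<open>Limits and colimits of small sets\<close>

text \<open>A diagram of sets is given by vertices \<open>I\<close> and edges \<open>K\<close> with source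
  \<open>s\<close> and target \<open>t\<close>; its limit does not depend on how edges compose. The
  universal property is stated elementwise, so that it applies to the two components of a model
  separately.\<close>

definition is_set_limit ::
  "'u set \<Rightarrow> ('u \<Rightarrow> 'u set) \<Rightarrow> 'u set \<Rightarrow> ('u \<Rightarrow> 'u) \<Rightarrow> ('u \<Rightarrow> 'u) \<Rightarrow> ('u \<Rightarrow> 'u \<Rightarrow> 'u) \<Rightarrow>
   'u set \<Rightarrow> ('u \<Rightarrow> 'u \<Rightarrow> 'u) \<Rightarrow> (('u \<Rightarrow> 'u) \<Rightarrow> 'u) \<Rightarrow> bool" where
  "is_set_limit I X K s t F L p lift \<longleftrightarrow>
     small L \<and>
     (\<forall>l\<in>L. \<forall>i\<in>I. p i l \<in> X i) \<and>
     (\<forall>l\<in>L. \<forall>k\<in>K. F k (p (s k) l) = p (t k) l) \<and>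
     (\<forall>x. (\<forall>i\<in>I. x i \<in> X i) \<longrightarrow> (\<forall>k\<in>K. F k (x (s k)) = x (t k)) \<longrightarrow>
        lift x \<in> L \<and> (\<forall>i\<in>I. p i (lift x) = x i)) \<and>
     (\<forall>l\<in>L. \<forall>l'\<in>L. (\<forall>i\<in>I. p i l = p i l') \<longrightarrow> l = l')"

lemma is_set_limitD:
  assumes "is_set_limit I X K s t F L p lift"
  shows "small L"
    "\<And>l i. l \<in> L \<Longrightarrow> i \<in> I \<Longrightarrow> p i l \<in> X i"
    "\<And>l k. l \<in> L \<Longrightarrow> k \<in> K \<Longrightarrow> F k (p (s k) l) = p (t k) l"
    "\<And>x. \<forall>i\<in>I. x i \<in> X i \<Longrightarrow> \<forall>k\<in>K. F k (x (s k)) = x (t k) \<Longrightarrow>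
      lift x \<in> L \<and> (\<forall>i\<in>I. p i (lift x) = x i)"
    "\<And>l l'. l \<in> L \<Longrightarrow> l' \<in> L \<Longrightarrow> \<forall>i\<in>I. p i l = p i l' \<Longrightarrow> l = l'"
  using assms unfolding is_set_limit_def by simp_all

text \<open>The compatible families form a subset of the product of the vertices, hence a set that
  can be coded in the universe.\<close>

lemma set_limit_exists:
  fixes X :: "'u \<Rightarrow> 'u set"
  assumes u: "universe TYPE('u)" and I: "small I" and X: "\<And>i. i \<in> I \<Longrightarrow> small (X i)"
    and st: "\<And>k. k \<in> K \<Longrightarrow> s k \<in> I \<and> t k \<in> I"
  shows "\<exists>L p lift. is_set_limit I X K s t F L p lift"
proof -
  define S where "S = {x \<in> PiE I X. \<forall>k\<in>K. F k (x (s k)) = x (t k)}"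
  have "S \<lesssim> PiE I X"
    unfolding S_def by (rule subset_imp_lepoll) blast
  then have S: "S \<prec> (UNIV :: 'u set)"
    using u I X by (blast intro: lesspoll_trans1 PiE_lesspoll_universe)
  obtain enc :: "('u \<Rightarrow> 'u) \<Rightarrow> 'u" and dec
    where enc: "small (enc ` S)" "\<And>x. x \<in> S \<Longrightarrow> dec (enc x) = x"
    using small_code[OF S] by blast
  \<comment> \<open>A given family may take arbitrary values off \<open>I\<close>, whereas members
    of \<open>S\<close> are extensional, hence the \<open>restrict\<close>. Compatibility survives
    it because edges start and end in \<open>I\<close>.\<close>
  have "is_set_limit I X K s t F (enc ` S) (\<lambda>i l. dec l i) (\<lambda>x. enc (restrict x I))"
    unfolding is_set_limit_def
  proof (intro conjI allI ballI impI)
    show "small (enc ` S)" by (fact enc)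
    show "dec l i \<in> X i" if "l \<in> enc ` S" "i \<in> I" for l i
      using that enc(2) unfolding S_def by auto
    show "F k (dec l (s k)) = dec l (t k)" if "l \<in> enc ` S" "k \<in> K" for l k
      using that enc(2) unfolding S_def by auto
    fix x
    assume x: "\<forall>i\<in>I. x i \<in> X i" "\<forall>k\<in>K. F k (x (s k)) = x (t k)"
    have "restrict x I \<in> S"
      using x st unfolding S_def by auto
    then show "enc (restrict x I) \<in> enc ` S" "\<And>i. i \<in> I \<Longrightarrow> dec (enc (restrict x I)) i = x i"
      using enc(2) by simp_all
  next
    show "l = l'" if l: "l \<in> enc ` S" "l' \<in> enc ` S" and eq: "\<forall>i\<in>I. dec l i = dec l' i" for l l'
    proof -
      obtain x x' where x: "x \<in> S" "l = enc x" "x' \<in> S" "l' = enc x'"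
        using l by blast
      then have "x = x'"
        using eq enc(2) unfolding S_def by (intro PiE_ext[of x I X x']) auto
      then show ?thesis
        using x by simp
    qed
  qed
  then show ?thesis by blast
qed

text \<open>Uniqueness of the induced map is stated as joint surjectivity of the injections. The
  families \<rho> take values anywhere in \<open>'u\<close>, with no target set; that
  \<open>desc\<close> lands in a given target is recovered from joint surjectivity.\<close>

definition is_set_colimit ::
  "'u set \<Rightarrow> ('u \<Rightarrow> 'u set) \<Rightarrow> 'u set \<Rightarrow> ('u \<Rightarrow> 'u) \<Rightarrow> ('u \<Rightarrow> 'u) \<Rightarrow> ('u \<Rightarrow> 'u \<Rightarrow> 'u) \<Rightarrow>
   'u set \<Rightarrow> ('u \<Rightarrow> 'u \<Rightarrow> 'u) \<Rightarrow> (('u \<Rightarrow> 'u \<Rightarrow> 'u) \<Rightarrow> 'u \<Rightarrow> 'u) \<Rightarrow> bool" where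
  "is_set_colimit I X K s t F Q \<iota> desc \<longleftrightarrow>
     small Q \<and>
     (\<forall>i\<in>I. \<forall>a\<in>X i. \<iota> i a \<in> Q) \<and>
     (\<forall>k\<in>K. \<forall>a\<in>X (s k). \<iota> (t k) (F k a) = \<iota> (s k) a) \<and>
     (\<forall>q\<in>Q. \<exists>i\<in>I. \<exists>a\<in>X i. q = \<iota> i a) \<and>
     (\<forall>\<rho>. (\<forall>k\<in>K. \<forall>a\<in>X (s k). \<rho> (t k) (F k a) = \<rho> (s k) a) \<longrightarrow>
        (\<forall>i\<in>I. \<forall>a\<in>X i. desc \<rho> (\<iota> i a) = \<rho> i a))"

lemma is_set_colimitD:
  assumes "is_set_colimit I X K s t F Q \<iota> desc"
  shows "small Q"
    "\<And>i a. i \<in> I \<Longrightarrow> a \<in> X i \<Longrightarrow> \<iota> i a \<in> Q"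
    "\<And>k a. k \<in> K \<Longrightarrow> a \<in> X (s k) \<Longrightarrow> \<iota> (t k) (F k a) = \<iota> (s k) a"
    "\<And>q. q \<in> Q \<Longrightarrow> \<exists>i\<in>I. \<exists>a\<in>X i. q = \<iota> i a"
    "\<And>\<rho> i a. \<forall>k\<in>K. \<forall>a\<in>X (s k). \<rho> (t k) (F k a) = \<rho> (s k) a \<Longrightarrow> i \<in> I \<Longrightarrow> a \<in> X i \<Longrightarrow>
      desc \<rho> (\<iota> i a) = \<rho> i a"
  using assms unfolding is_set_colimit_def by simp_all

text \<open>Two elements of the disjoint union are identified when no compatible family of maps into
  the universe separates them; this avoids describing the equivalence relation generated by the
  diagram.\<close>

lemma set_colimit_exists:
  fixes X :: "'u \<Rightarrow> 'u set"
  assumes u: "universe TYPE('u)" and I: "small I" and X: "\<And>i. i \<in> I \<Longrightarrow> small (X i)"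
  shows "\<exists>Q \<iota> desc. is_set_colimit I X K s t F Q \<iota> desc"
proof -
  define compat where
    "compat \<rho> \<longleftrightarrow> (\<forall>k\<in>K. \<forall>a\<in>X (s k). \<rho> (t k) (F k a) = \<rho> (s k) a)" for \<rho> :: "'u \<Rightarrow> 'u \<Rightarrow> 'u"
  define cls where
    "cls i a = {(j, b) \<in> Sigma I X. \<forall>\<rho>. compat \<rho> \<longrightarrow> \<rho> i a = \<rho> j b}" for i a
  define S where "S = (\<lambda>(i, a). cls i a) ` Sigma I X"
  have "S \<lesssim> Sigma I X"
    unfolding S_def by (rule image_lepoll)
  then have S: "S \<prec> (UNIV :: 'u set)"
    using u I X by (blast intro: lesspoll_trans1 Sigma_lesspoll_universe)
  obtain enc :: "('u \<times> 'u) set \<Rightarrow> 'u" and dec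
    where enc: "small (enc ` S)" "\<And>x. x \<in> S \<Longrightarrow> dec (enc x) = x"
    using small_code[OF S] by blast
  have cls_S: "cls i a \<in> S" if "i \<in> I" "a \<in> X i" for i a
    using that unfolding S_def by force
  \<comment> \<open>Any representative will do for the descended map: by definition of
    \<open>cls\<close>, a compatible \<rho> is constant on each class.\<close>
  have "is_set_colimit I X K s t F (enc ` S) (\<lambda>i a. enc (cls i a))
      (\<lambda>\<rho> q. case_prod \<rho> (SOME jb. jb \<in> dec q))"
    unfolding is_set_colimit_def
  proof (intro conjI allI ballI impI)
    show "small (enc ` S)" by (fact enc)
    show "enc (cls i a) \<in> enc ` S" if "i \<in> I" "a \<in> X i" for i a
      using cls_S[OF that] by blast
    show "enc (cls (t k) (F k a)) = enc (cls (s k) a)" if "k \<in> K" "a \<in> X (s k)" for k a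
      using that unfolding cls_def compat_def by auto
    show "\<exists>i\<in>I. \<exists>a\<in>X i. q = enc (cls i a)" if "q \<in> enc ` S" for q
      using that unfolding S_def by auto
    show "case_prod \<rho> (SOME jb. jb \<in> dec (enc (cls i a))) = \<rho> i a"
      if \<rho>: "\<forall>k\<in>K. \<forall>a\<in>X (s k). \<rho> (t k) (F k a) = \<rho> (s k) a" and ia: "i \<in> I" "a \<in> X i" for \<rho> :: "'u \<Rightarrow> 'u \<Rightarrow> 'u" and i a
    proof -
      have "(i, a) \<in> cls i a"
        using ia unfolding cls_def by simp
      then have "(SOME jb. jb \<in> cls i a) \<in> cls i a"
        by (rule someI)
      moreover obtain j b where jb: "(SOME jb. jb \<in> cls i a) = (j, b)"
        by fastforce
      ultimately have "\<rho> i a = \<rho> j b"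
        using \<rho> unfolding cls_def compat_def by simp
      then show ?thesis
        by (simp add: enc(2)[OF cls_S[OF ia]] jb)
    qed
  qed
  then show ?thesis by blast
qed


section \<open>Products and right adjoints from universal arrows\<close>

text \<open>The pair of r and \<epsilon> is a universal arrow from \<open>L\<close> to d, and
  \<epsilon> becomes the counit. Choosing one pair for each d defines the right adjoint on objects;
  every equation then follows from uniqueness, by checking that both sides have the same composite
  with the counit.\<close>

lemma has_right_adjointI:
  assumes L: "is_functor C D L"
    and univ: "\<And>d. d \<in> Obj D \<Longrightarrow> \<exists>r \<epsilon>. r \<in> Obj C \<and> \<epsilon> \<in> Hom D (ObjMap L r) d \<and>
      (\<forall>c\<in>Obj C. \<forall>f\<in>Hom D (ObjMap L c) d.
        \<exists>!g. g \<in> Hom C c r \<and> Comp D \<epsilon> (ArrMap L g) = f)"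
  shows "has_right_adjoint C D L"
proof -
  interpret C: category C using L unfolding is_functor_def by blast
  interpret D: category D using L unfolding is_functor_def by blast
  have L_Obj: "\<And>c. c \<in> Obj C \<Longrightarrow> ObjMap L c \<in> Obj D"
    and L_Hom: "\<And>c c' u. u \<in> Hom C c c' \<Longrightarrow> ArrMap L u \<in> Hom D (ObjMap L c) (ObjMap L c')"
    and L_Id: "\<And>c. c \<in> Obj C \<Longrightarrow> ArrMap L (Id C c) = Id D (ObjMap L c)"
    and L_Comp: "\<And>c c' c'' u v. u \<in> Hom C c c' \<Longrightarrow> v \<in> Hom C c' c'' \<Longrightarrow>
      ArrMap L (Comp C v u) = Comp D (ArrMap L v) (ArrMap L u)"
    using L unfolding is_functor_def by blast+
  have C_Hom: "c \<in> Obj C \<and> c' \<in> Obj C" if "u \<in> Hom C c c'" for c c' u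
    using that C.Dom_in_Obj C.Cod_in_Obj unfolding Hom_def by blast
  have D_Hom: "d \<in> Obj D \<and> d' \<in> Obj D" if "v \<in> Hom D d d'" for d d' v
    using that D.Dom_in_Obj D.Cod_in_Obj unfolding Hom_def by blast
  obtain r \<epsilon> where
    r: "\<And>d. d \<in> Obj D \<Longrightarrow> r d \<in> Obj C" and
    \<epsilon>: "\<And>d. d \<in> Obj D \<Longrightarrow> \<epsilon> d \<in> Hom D (ObjMap L (r d)) d" and
    ex1: "\<And>c d f. d \<in> Obj D \<Longrightarrow> c \<in> Obj C \<Longrightarrow> f \<in> Hom D (ObjMap L c) d \<Longrightarrow>
      \<exists>!g. g \<in> Hom C c (r d) \<and> Comp D (\<epsilon> d) (ArrMap L g) = f"
    using univ by metis
  define \<phi> where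
    "\<phi> c d f = (THE g. g \<in> Hom C c (r d) \<and> Comp D (\<epsilon> d) (ArrMap L g) = f)" for c d f
  \<comment> \<open>An arrow \<open>v\<close> out of \<open>d\<close> goes to the transpose of
    \<open>v\<close> after the counit at \<open>d\<close>, the only value that makes the counit
    natural.\<close>
  define R where
    "R = \<lparr>ObjMap = r, ArrMap = \<lambda>v. \<phi> (r (Dom D v)) (Cod D v) (Comp D v (\<epsilon> (Dom D v)))\<rparr>"
  have \<phi>: "\<phi> c d f \<in> Hom C c (r d)" "Comp D (\<epsilon> d) (ArrMap L (\<phi> c d f)) = f"
    if "c \<in> Obj C" "d \<in> Obj D" "f \<in> Hom D (ObjMap L c) d" for c d f
    using theI'[OF ex1[OF that(2,1,3)]] unfolding \<phi>_def by blast+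
  have \<epsilon>L: "Comp D (\<epsilon> d) (ArrMap L g) \<in> Hom D (ObjMap L c) d"
    if "g \<in> Hom C c (r d)" "d \<in> Obj D" for c d g
    using D.Comp_in_Hom[OF L_Hom[OF that(1)] \<epsilon>[OF that(2)]] .
  have \<phi>_eq: "\<phi> c d f = g"
    if "g \<in> Hom C c (r d)" "d \<in> Obj D" "Comp D (\<epsilon> d) (ArrMap L g) = f" for c d f g
    using ex1[OF that(2)] \<epsilon>L[OF that(1,2)] C_Hom[OF that(1)] that
    unfolding \<phi>_def by (intro the1_equality) auto
  have ObjR [simp]: "ObjMap R d = r d" for d
    unfolding R_def by simp
  have R: "ArrMap R v \<in> Hom C (r d) (r d')"
    "Comp D (\<epsilon> d') (ArrMap L (ArrMap R v)) = Comp D v (\<epsilon> d)"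
    and R_eq: "\<And>g. g \<in> Hom C (r d) (r d') \<Longrightarrow> Comp D (\<epsilon> d') (ArrMap L g) = Comp D v (\<epsilon> d) \<Longrightarrow>
      ArrMap R v = g"
    if v: "v \<in> Hom D d d'" for d d' v
  proof -
    have [simp]: "Dom D v = d" "Cod D v = d'" and d: "d \<in> Obj D" "d' \<in> Obj D"
      using v D_Hom[OF v] unfolding Hom_def by auto
    have "Comp D v (\<epsilon> d) \<in> Hom D (ObjMap L (r d)) d'"
      using D.Comp_in_Hom[OF \<epsilon>[OF d(1)] v] .
    then show "ArrMap R v \<in> Hom C (r d) (r d')"
      "Comp D (\<epsilon> d') (ArrMap L (ArrMap R v)) = Comp D v (\<epsilon> d)"
      using \<phi>[OF r[OF d(1)] d(2)] unfolding R_def by simp_all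
    show "ArrMap R v = g"
      if "g \<in> Hom C (r d) (r d')" "Comp D (\<epsilon> d') (ArrMap L g) = Comp D v (\<epsilon> d)" for g
      using \<phi>_eq[OF that(1) d(2) that(2)] unfolding R_def by simp
  qed
  have "is_functor D C R"
    unfolding is_functor_def
  proof (intro conjI allI ballI)
    show "category D" "category C" by unfold_locales
    show "ObjMap R d \<in> Obj C" if "d \<in> Obj D" for d
      using r[OF that] by simp
    show "ArrMap R v \<in> Hom C (ObjMap R d) (ObjMap R d')" if "v \<in> Hom D d d'" for d d' v
      using R(1)[OF that] by simp
    show "ArrMap R (Id D d) = Id C (ObjMap R d)" if d: "d \<in> Obj D" for d
    proof -
      have "Comp D (\<epsilon> d) (ArrMap L (Id C (r d))) = \<epsilon> d"
        using D.Comp_Id[OF \<epsilon>[OF d]] L_Id[OF r[OF d]] by simp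
      also have "\<epsilon> d = Comp D (Id D d) (\<epsilon> d)"
        using D.Id_Comp[OF \<epsilon>[OF d]] by simp
      finally show ?thesis
        using R_eq[OF D.Id_in_Hom[OF d] C.Id_in_Hom[OF r[OF d]]] by simp
    qed
    show "ArrMap R (Comp D w v) = Comp C (ArrMap R w) (ArrMap R v)"
      if v: "v \<in> Hom D d d'" and w: "w \<in> Hom D d' d''" for d d' d'' v w
    \<comment> \<open>By \<open>R_eq\<close> it is enough that the proposed composite satisfies the
      naturality square of \<epsilon>, which is pasted from the squares for \<open>v\<close> and
      \<open>w\<close>.\<close>
    proof (rule R_eq[OF D.Comp_in_Hom[OF v w] C.Comp_in_Hom[OF R(1)[OF v] R(1)[OF w]]])
      have d: "d \<in> Obj D" "d' \<in> Obj D" "d'' \<in> Obj D"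
        using D_Hom[OF v] D_Hom[OF w] by auto
      note L_Rv = L_Hom[OF R(1)[OF v]] and L_Rw = L_Hom[OF R(1)[OF w]]
      have "Comp D (\<epsilon> d'') (ArrMap L (Comp C (ArrMap R w) (ArrMap R v))) =
          Comp D (Comp D (\<epsilon> d'') (ArrMap L (ArrMap R w))) (ArrMap L (ArrMap R v))"
        unfolding L_Comp[OF R(1)[OF v] R(1)[OF w]] by (rule D.Comp_assoc[OF L_Rv L_Rw \<epsilon>[OF d(3)]])
      also have "\<dots> = Comp D w (Comp D (\<epsilon> d') (ArrMap L (ArrMap R v)))"
        unfolding R(2)[OF w] by (rule D.Comp_assoc[OF L_Rv \<epsilon>[OF d(2)] w, symmetric])
      also have "\<dots> = Comp D (Comp D w v) (\<epsilon> d)"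
        unfolding R(2)[OF v] by (rule D.Comp_assoc[OF \<epsilon>[OF d(1)] v w])
      finally show "Comp D (\<epsilon> d'') (ArrMap L (Comp C (ArrMap R w) (ArrMap R v))) =
        Comp D (Comp D w v) (\<epsilon> d)" .
    qed
  qed
  moreover have "bij_betw (\<phi> c d) (Hom D (ObjMap L c) d) (Hom C c (ObjMap R d))"
    if "c \<in> Obj C" "d \<in> Obj D" for c d
  proof (rule bij_betw_byWitness[where f' = "\<lambda>g. Comp D (\<epsilon> d) (ArrMap L g)"])
    show "\<forall>f\<in>Hom D (ObjMap L c) d. Comp D (\<epsilon> d) (ArrMap L (\<phi> c d f)) = f"
      using \<phi>(2)[OF that] by blast
    show "\<forall>g\<in>Hom C c (ObjMap R d). \<phi> c d (Comp D (\<epsilon> d) (ArrMap L g)) = g"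
      using \<phi>_eq that(2) by simp
    show "\<phi> c d ` Hom D (ObjMap L c) d \<subseteq> Hom C c (ObjMap R d)"
      using \<phi>(1)[OF that] by auto
    show "(\<lambda>g. Comp D (\<epsilon> d) (ArrMap L g)) ` Hom C c (ObjMap R d) \<subseteq> Hom D (ObjMap L c) d"
      using \<epsilon>L that(2) by auto
  qed
  moreover have "\<phi> c' d' (Comp D v (Comp D f (ArrMap L u))) =
      Comp C (ArrMap R v) (Comp C (\<phi> c d f) u)"
    if u: "u \<in> Hom C c' c" and v: "v \<in> Hom D d d'" and f: "f \<in> Hom D (ObjMap L c) d"
    for c' c d d' u v f
  proof -
    have c: "c \<in> Obj C" "d \<in> Obj D" "d' \<in> Obj D"
      using C_Hom[OF u] D_Hom[OF v] by auto
    note \<phi>f = \<phi>[OF c(1,2) f]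
    note \<phi>fu = C.Comp_in_Hom[OF u \<phi>f(1)]
    show ?thesis
    proof (rule \<phi>_eq[OF C.Comp_in_Hom[OF \<phi>fu R(1)[OF v]] c(3)])
      have "Comp D (\<epsilon> d') (ArrMap L (Comp C (ArrMap R v) (Comp C (\<phi> c d f) u))) =
          Comp D (Comp D (\<epsilon> d') (ArrMap L (ArrMap R v))) (ArrMap L (Comp C (\<phi> c d f) u))"
        unfolding L_Comp[OF \<phi>fu R(1)[OF v]]
        by (rule D.Comp_assoc[OF L_Hom[OF \<phi>fu] L_Hom[OF R(1)[OF v]] \<epsilon>[OF c(3)]])
      also have "\<dots> = Comp D v (Comp D (\<epsilon> d) (ArrMap L (Comp C (\<phi> c d f) u)))"
        unfolding R(2)[OF v] by (rule D.Comp_assoc[OF L_Hom[OF \<phi>fu] \<epsilon>[OF c(2)] v, symmetric])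
      also have "Comp D (\<epsilon> d) (ArrMap L (Comp C (\<phi> c d f) u)) =
          Comp D (Comp D (\<epsilon> d) (ArrMap L (\<phi> c d f))) (ArrMap L u)"
        unfolding L_Comp[OF u \<phi>f(1)]
        by (rule D.Comp_assoc[OF L_Hom[OF u] L_Hom[OF \<phi>f(1)] \<epsilon>[OF c(2)]])
      finally show "Comp D (\<epsilon> d') (ArrMap L (Comp C (ArrMap R v) (Comp C (\<phi> c d f) u))) =
          Comp D v (Comp D f (ArrMap L u))"
        unfolding \<phi>f(2) .
    qed
  qed
  ultimately have "is_adjunction C D L R \<phi>"
    unfolding is_adjunction_def using L by blast
  then show ?thesis
    unfolding has_right_adjoint_def by blast
qed

text \<open>Arrows are sent to the map induced by the universal property, and its uniqueness gives
  functoriality. Exporting \<open>ObjMap T = P\<close> lets later arguments compute with a concrete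
  product, while the action on arrows is known only through the projections.\<close>

lemma times_functor_exists:
  assumes "category C" and x: "x \<in> Obj C"
    and prod: "\<And>y. y \<in> Obj C \<Longrightarrow> is_product C x y (P y) (\<pi>1 y) (\<pi>2 y)"
  obtains T where "is_times_functor C x T \<pi>1 \<pi>2" "ObjMap T = P"
proof -
  interpret category C by fact
  define pair where
    "pair w z f g = (THE h. h \<in> Hom C w (P z) \<and> Comp C (\<pi>1 z) h = f \<and> Comp C (\<pi>2 z) h = g)"
    for w z f g
  define T where
    "T = \<lparr>ObjMap = P, ArrMap = \<lambda>f. pair (P (Dom C f)) (Cod C f) (\<pi>1 (Dom C f)) (Comp C f (\<pi>2 (Dom C f)))\<rparr>"
  have P: "P y \<in> Obj C" and \<pi>1: "\<pi>1 y \<in> Hom C (P y) x" and \<pi>2: "\<pi>2 y \<in> Hom C (P y) y"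
    and ex1: "\<And>w f g. f \<in> Hom C w x \<Longrightarrow> g \<in> Hom C w y \<Longrightarrow>
      \<exists>!h. h \<in> Hom C w (P y) \<and> Comp C (\<pi>1 y) h = f \<and> Comp C (\<pi>2 y) h = g"
    if "y \<in> Obj C" for y
    using prod[OF that] unfolding is_product_def by blast+
  have Hom_Obj: "y \<in> Obj C \<and> z \<in> Obj C" if "f \<in> Hom C y z" for f y z
    using that Dom_in_Obj Cod_in_Obj unfolding Hom_def by blast
  have T: "ArrMap T f \<in> Hom C (P y) (P z)" "Comp C (\<pi>1 z) (ArrMap T f) = \<pi>1 y"
    "Comp C (\<pi>2 z) (ArrMap T f) = Comp C f (\<pi>2 y)"
    and T_eq: "\<And>h. h \<in> Hom C (P y) (P z) \<Longrightarrow> Comp C (\<pi>1 z) h = \<pi>1 y \<Longrightarrow>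
      Comp C (\<pi>2 z) h = Comp C f (\<pi>2 y) \<Longrightarrow> ArrMap T f = h"
    if f: "f \<in> Hom C y z" for f y z
  proof -
    have yz: "y \<in> Obj C" "z \<in> Obj C" and [simp]: "Dom C f = y" "Cod C f = z"
      using Hom_Obj[OF f] f unfolding Hom_def by auto
    note ex = ex1[OF yz(2) \<pi>1[OF yz(1)] Comp_in_Hom[OF \<pi>2[OF yz(1)] f]]
    have Tf: "ArrMap T f = pair (P y) z (\<pi>1 y) (Comp C f (\<pi>2 y))"
      unfolding T_def by simp
    have "ArrMap T f \<in> Hom C (P y) (P z) \<and> Comp C (\<pi>1 z) (ArrMap T f) = \<pi>1 y \<and>
        Comp C (\<pi>2 z) (ArrMap T f) = Comp C f (\<pi>2 y)"
      unfolding Tf pair_def by (rule theI'[OF ex])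
    then show "ArrMap T f \<in> Hom C (P y) (P z)" "Comp C (\<pi>1 z) (ArrMap T f) = \<pi>1 y"
      "Comp C (\<pi>2 z) (ArrMap T f) = Comp C f (\<pi>2 y)"
      by blast+
    show "ArrMap T f = h" if "h \<in> Hom C (P y) (P z)" "Comp C (\<pi>1 z) h = \<pi>1 y"
      "Comp C (\<pi>2 z) h = Comp C f (\<pi>2 y)" for h
      unfolding Tf pair_def by (rule the1_equality[OF ex]) (use that in blast)
  qed
  have "is_functor C C T"
    unfolding is_functor_def
  proof (intro conjI allI ballI)
    show "category C" "category C" by fact+
    show "ObjMap T y \<in> Obj C" if "y \<in> Obj C" for y
      using P[OF that] unfolding T_def by simp
    show "ArrMap T f \<in> Hom C (ObjMap T y) (ObjMap T z)" if "f \<in> Hom C y z" for f y z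
      using T(1)[OF that] unfolding T_def by simp
    show "ArrMap T (Id C y) = Id C (ObjMap T y)" if y: "y \<in> Obj C" for y
    proof -
      have "ArrMap T (Id C y) = Id C (P y)"
        using T_eq[OF Id_in_Hom[OF y] Id_in_Hom[OF P[OF y]]]
          Comp_Id[OF \<pi>1[OF y]] Comp_Id[OF \<pi>2[OF y]] Id_Comp[OF \<pi>2[OF y]] by simp
      then show ?thesis unfolding T_def by simp
    qed
    show "ArrMap T (Comp C g f) = Comp C (ArrMap T g) (ArrMap T f)"
      if f: "f \<in> Hom C y z" and g: "g \<in> Hom C z w" for f g y z w
    proof (rule T_eq[OF Comp_in_Hom[OF f g] Comp_in_Hom[OF T(1)[OF f] T(1)[OF g]]])
      have y: "y \<in> Obj C" "z \<in> Obj C" "w \<in> Obj C"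
        using Hom_Obj[OF f] Hom_Obj[OF g] by auto
      show "Comp C (\<pi>1 w) (Comp C (ArrMap T g) (ArrMap T f)) = \<pi>1 y"
        using Comp_assoc[OF T(1)[OF f] T(1)[OF g] \<pi>1[OF y(3)]] T(2)[OF f] T(2)[OF g] by simp
      show "Comp C (\<pi>2 w) (Comp C (ArrMap T g) (ArrMap T f)) = Comp C (Comp C g f) (\<pi>2 y)"
        using Comp_assoc[OF T(1)[OF f] T(1)[OF g] \<pi>2[OF y(3)]] T(3)[OF f] T(3)[OF g]
          Comp_assoc[OF T(1)[OF f] \<pi>2[OF y(2)] g] Comp_assoc[OF \<pi>2[OF y(1)] f g] by simp
    qed
  qed
  then have "is_times_functor C x T \<pi>1 \<pi>2"
    unfolding is_times_functor_def using prod T(2,3) by (auto simp: T_def)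
  moreover have "ObjMap T = P"
    unfolding T_def by simp
  ultimately show thesis
    using that by blast
qed


section \<open>The category of topos causal models\<close>

text \<open>Restricting \<open>F\<close> makes the mechanism extensional, so constructions may
  describe it by any total function.\<close>

definition mk_tcm :: "'u set \<Rightarrow> 'u set \<Rightarrow> ('u \<Rightarrow> 'u) \<Rightarrow> 'u tcm" where
  "mk_tcm U V F = \<lparr>Exo = U, Endo = V, Mech = restrict F U\<rparr>"

lemma mk_tcm_sel [simp]:
  "Exo (mk_tcm U V F) = U" "Endo (mk_tcm U V F) = V"
  "u \<in> U \<Longrightarrow> Mech (mk_tcm U V F) u = F u"
  unfolding mk_tcm_def by simp_all

lemma is_tcm_mk_tcm:
  assumes "small U" "small V" "\<And>u. u \<in> U \<Longrightarrow> F u \<in> V"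
  shows "is_tcm (mk_tcm U V F)"
  using assms unfolding is_tcm_def mk_tcm_def by auto

lemma is_tcmD:
  assumes "is_tcm M"
  shows "small (Exo M)" "small (Endo M)" "u \<in> Exo M \<Longrightarrow> Mech M u \<in> Endo M"
  using assms unfolding is_tcm_def by auto

lemma Obj_TCM [simp]: "M \<in> Obj TCM \<longleftrightarrow> is_tcm M"
  unfolding TCM_def by simp

lemma Arr_TCM [simp]: "f \<in> Arr TCM \<longleftrightarrow> is_tcm_arrow f"
  unfolding TCM_def by simp

lemma Dom_TCM [simp]: "Dom TCM = Source" and Cod_TCM [simp]: "Cod TCM = Target"
  unfolding TCM_def by simp_all

lemma Hom_TCM_D:
  assumes "f \<in> Hom TCM M N"
  shows "is_tcm_arrow f" "Source f = M" "Target f = N" "is_tcm M" "is_tcm N"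
    "u \<in> Exo M \<Longrightarrow> ExoMap f u \<in> Exo N"
    "v \<in> Endo M \<Longrightarrow> EndoMap f v \<in> Endo N"
    "u \<in> Exo M \<Longrightarrow> EndoMap f (Mech M u) = Mech N (ExoMap f u)"
proof -
  show f: "is_tcm_arrow f" "Source f = M" "Target f = N"
    using assms unfolding Hom_def by auto
  show "is_tcm M" "is_tcm N"
    and "u \<in> Exo M \<Longrightarrow> ExoMap f u \<in> Exo N" and "v \<in> Endo M \<Longrightarrow> EndoMap f v \<in> Endo N"
    using f unfolding is_tcm_arrow_def by auto
  show "EndoMap f (Mech M u) = Mech N (ExoMap f u)" if "u \<in> Exo M"
  proof -
    have "compose (Exo M) (EndoMap f) (Mech M) u = compose (Exo M) (Mech N) (ExoMap f) u"
      using f unfolding is_tcm_arrow_def by simp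
    then show ?thesis
      using that by (simp add: compose_eq)
  qed
qed

text \<open>The component maps are extensional, so agreement on the carriers already determines them
  everywhere.\<close>

lemma Hom_TCM_eqI:
  assumes f: "f \<in> Hom TCM M N" and g: "g \<in> Hom TCM M N"
    and "\<And>u. u \<in> Exo M \<Longrightarrow> ExoMap f u = ExoMap g u"
    and "\<And>v. v \<in> Endo M \<Longrightarrow> EndoMap f v = EndoMap g v"
  shows "f = g"
proof -
  have "ExoMap f = ExoMap g" "EndoMap f = EndoMap g"
    using Hom_TCM_D(1-3)[OF f] Hom_TCM_D(1-3)[OF g] assms(3,4)
    unfolding is_tcm_arrow_def by (auto intro: PiE_ext)
  then show ?thesis
    using Hom_TCM_D(2,3)[OF f] Hom_TCM_D(2,3)[OF g] by simp
qed

definition mk_arrow :: "'u tcm \<Rightarrow> 'u tcm \<Rightarrow> ('u \<Rightarrow> 'u) \<Rightarrow> ('u \<Rightarrow> 'u) \<Rightarrow> 'u tcm_arrow" where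
  "mk_arrow M N h g =
    \<lparr>Source = M, Target = N, ExoMap = restrict h (Exo M), EndoMap = restrict g (Endo M)\<rparr>"

lemma mk_arrow_sel [simp]:
  "Source (mk_arrow M N h g) = M" "Target (mk_arrow M N h g) = N"
  "u \<in> Exo M \<Longrightarrow> ExoMap (mk_arrow M N h g) u = h u"
  "v \<in> Endo M \<Longrightarrow> EndoMap (mk_arrow M N h g) v = g v"
  unfolding mk_arrow_def by simp_all

lemma mk_arrow_in_Hom:
  assumes "is_tcm M" "is_tcm N"
    and "\<And>u. u \<in> Exo M \<Longrightarrow> h u \<in> Exo N" "\<And>v. v \<in> Endo M \<Longrightarrow> g v \<in> Endo N"
    and "\<And>u. u \<in> Exo M \<Longrightarrow> g (Mech M u) = Mech N (h u)"
  shows "mk_arrow M N h g \<in> Hom TCM M N"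
  using assms is_tcmD(3)[OF assms(1)]
  by (auto simp: Hom_def is_tcm_arrow_def mk_arrow_def compose_def fun_eq_iff)

lemma Comp_TCM_sel:
  assumes "f \<in> Hom TCM M N"
  shows "u \<in> Exo M \<Longrightarrow> ExoMap (Comp TCM g f) u = ExoMap g (ExoMap f u)"
    "v \<in> Endo M \<Longrightarrow> EndoMap (Comp TCM g f) v = EndoMap g (EndoMap f v)"
  using Hom_TCM_D(2)[OF assms] unfolding TCM_def by (simp_all add: compose_eq)

lemma Id_TCM_sel:
  "u \<in> Exo M \<Longrightarrow> ExoMap (Id TCM M) u = u" "v \<in> Endo M \<Longrightarrow> EndoMap (Id TCM M) v = v"
  unfolding TCM_def by simp_all

lemma Id_TCM_in_Hom: "is_tcm M \<Longrightarrow> Id TCM M \<in> Hom TCM M M"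
  using mk_arrow_in_Hom[of M M id id] by (simp add: TCM_def mk_arrow_def)

lemma Comp_TCM_in_Hom:
  assumes f: "f \<in> Hom TCM M N" and g: "g \<in> Hom TCM N P"
  shows "Comp TCM g f \<in> Hom TCM M P"
proof -
  have "Comp TCM g f = mk_arrow M P (ExoMap g \<circ> ExoMap f) (EndoMap g \<circ> EndoMap f)"
    using Hom_TCM_D(2,3)[OF f] Hom_TCM_D(2,3)[OF g]
    by (simp add: TCM_def mk_arrow_def compose_def o_def)
  also have "\<dots> \<in> Hom TCM M P"
    by (rule mk_arrow_in_Hom)
      (use Hom_TCM_D[OF f] Hom_TCM_D[OF g] in auto)
  finally show ?thesis .
qed

text \<open>Turns a commuting triangle of models into pointwise equations on the two carriers, the
  form in which most universal properties below are checked.\<close>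

lemma Comp_TCM_eq_iff:
  assumes f: "f \<in> Hom TCM M N" and g: "g \<in> Hom TCM N P" and h: "h \<in> Hom TCM M P"
  shows "Comp TCM g f = h \<longleftrightarrow>
    (\<forall>u\<in>Exo M. ExoMap g (ExoMap f u) = ExoMap h u) \<and>
    (\<forall>v\<in>Endo M. EndoMap g (EndoMap f v) = EndoMap h v)"
proof
  assume "Comp TCM g f = h"
  then show "(\<forall>u\<in>Exo M. ExoMap g (ExoMap f u) = ExoMap h u) \<and>
      (\<forall>v\<in>Endo M. EndoMap g (EndoMap f v) = EndoMap h v)"
    using Comp_TCM_sel[OF f, of _ g] by auto
next
  assume "(\<forall>u\<in>Exo M. ExoMap g (ExoMap f u) = ExoMap h u) \<and>
      (\<forall>v\<in>Endo M. EndoMap g (EndoMap f v) = EndoMap h v)"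
  then show "Comp TCM g f = h"
    by (intro Hom_TCM_eqI[OF Comp_TCM_in_Hom[OF f g] h]) (simp_all add: Comp_TCM_sel[OF f])
qed

lemma category_TCM: "category TCM"
proof
  fix M N P Q :: "'u tcm" and f g h :: "'u tcm_arrow"
  show "f \<in> Arr TCM \<Longrightarrow> Dom TCM f \<in> Obj TCM" "f \<in> Arr TCM \<Longrightarrow> Cod TCM f \<in> Obj TCM"
    by (simp_all add: is_tcm_arrow_def)
  show "M \<in> Obj TCM \<Longrightarrow> Id TCM M \<in> Hom TCM M M"
    by (simp add: Id_TCM_in_Hom)
  show "f \<in> Hom TCM M N \<Longrightarrow> g \<in> Hom TCM N P \<Longrightarrow> Comp TCM g f \<in> Hom TCM M P"
    by (rule Comp_TCM_in_Hom)
  show "Comp TCM f (Id TCM M) = f" "Comp TCM (Id TCM N) f = f" if f: "f \<in> Hom TCM M N"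
    using Comp_TCM_eq_iff[OF Id_TCM_in_Hom f f] Comp_TCM_eq_iff[OF f Id_TCM_in_Hom f]
      Hom_TCM_D[OF f] by (simp_all add: Id_TCM_sel)
  show "Comp TCM h (Comp TCM g f) = Comp TCM (Comp TCM h g) f"
    if f: "f \<in> Hom TCM M N" and g: "g \<in> Hom TCM N P" and h: "h \<in> Hom TCM P Q"
    by (rule Hom_TCM_eqI[OF Comp_TCM_in_Hom[OF Comp_TCM_in_Hom[OF f g] h]
          Comp_TCM_in_Hom[OF f Comp_TCM_in_Hom[OF g h]]])
      (simp_all add: Comp_TCM_sel[OF f] Comp_TCM_sel[OF g] Comp_TCM_sel[OF Comp_TCM_in_Hom[OF f g]]
        Hom_TCM_D[OF f])
qed


section \<open>Limits and colimits of models\<close>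

lemma TCM_has_small_limits:
  assumes u: "universe TYPE('u)"
  shows "has_small_limits TYPE('u) (TCM :: ('u tcm, 'u tcm_arrow) cat)"
  unfolding has_small_limits_def
proof (intro allI impI, elim conjE)
  fix J :: "('u, 'u) cat" and D :: "('u, 'u, 'u tcm, 'u tcm_arrow) cat_map"
  assume "small_category J" and D: "is_functor J TCM D"
  then interpret J: category J by (simp add: small_category_def)
  have I: "small (Obj J)"
    using \<open>small_category J\<close> by (simp add: small_category_def)
  have st: "Dom J k \<in> Obj J \<and> Cod J k \<in> Obj J" if "k \<in> Arr J" for k
    using that J.Dom_in_Obj J.Cod_in_Obj by blast
  have D_Obj: "is_tcm (ObjMap D i)" if "i \<in> Obj J" for i
    using D that unfolding is_functor_def by auto
  have D_small: "small (Exo (ObjMap D i))" "small (Endo (ObjMap D i))" if "i \<in> Obj J" for i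
    using is_tcmD(1,2)[OF D_Obj[OF that]] .
  have D_Hom: "ArrMap D k \<in> Hom TCM (ObjMap D (Dom J k)) (ObjMap D (Cod J k))" if "k \<in> Arr J" for k
    using D that unfolding is_functor_def by (auto simp: Hom_def)
  have "\<exists>L p lift. is_set_limit (Obj J) (\<lambda>i. Exo (ObjMap D i)) (Arr J) (Dom J) (Cod J)
      (\<lambda>k. ExoMap (ArrMap D k)) L p lift"
    by (rule set_limit_exists[OF u I]) (simp_all add: D_small st)
  then obtain L0 p0 lift0 where "is_set_limit (Obj J) (\<lambda>i. Exo (ObjMap D i)) (Arr J) (Dom J) (Cod J)
      (\<lambda>k. ExoMap (ArrMap D k)) L0 p0 lift0"
    by blast
  note L0 = is_set_limitD[OF this]
  have "\<exists>L p lift. is_set_limit (Obj J) (\<lambda>i. Endo (ObjMap D i)) (Arr J) (Dom J) (Cod J)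
      (\<lambda>k. EndoMap (ArrMap D k)) L p lift"
    by (rule set_limit_exists[OF u I]) (simp_all add: D_small st)
  then obtain L1 p1 lift1 where "is_set_limit (Obj J) (\<lambda>i. Endo (ObjMap D i)) (Arr J) (Dom J) (Cod J)
      (\<lambda>k. EndoMap (ArrMap D k)) L1 p1 lift1"
    by blast
  note L1 = is_set_limitD[OF this]
  \<comment> \<open>The mechanisms applied to a compatible exogenous family give a compatible
    endogenous one, because each arrow of the diagram commutes with the mechanisms.\<close>
  define m where "m l = lift1 (\<lambda>i. Mech (ObjMap D i) (p0 i l))" for l
  have m: "m l \<in> L1 \<and> (\<forall>i\<in>Obj J. p1 i (m l) = Mech (ObjMap D i) (p0 i l))" if "l \<in> L0" for l
    unfolding m_def
  proof (rule L1(4))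
    show "\<forall>i\<in>Obj J. Mech (ObjMap D i) (p0 i l) \<in> Endo (ObjMap D i)"
      using L0(2)[OF that] is_tcmD(3)[OF D_Obj] by blast
    show "\<forall>k\<in>Arr J. EndoMap (ArrMap D k) (Mech (ObjMap D (Dom J k)) (p0 (Dom J k) l)) =
        Mech (ObjMap D (Cod J k)) (p0 (Cod J k) l)"
      using Hom_TCM_D(8)[OF D_Hom] L0(2)[OF that] L0(3)[OF that] st by simp
  qed
  define L where "L = mk_tcm L0 L1 m"
  define \<pi> where "\<pi> i = mk_arrow L (ObjMap D i) (p0 i) (p1 i)" for i
  have [simp]: "Exo L = L0" "Endo L = L1" "l \<in> L0 \<Longrightarrow> Mech L l = m l" for l
    unfolding L_def by simp_all
  have L: "is_tcm L"
    unfolding L_def using L0(1) L1(1) m by (blast intro: is_tcm_mk_tcm)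
  have \<pi>: "\<pi> i \<in> Hom TCM L (ObjMap D i)" if "i \<in> Obj J" for i
    unfolding \<pi>_def by (rule mk_arrow_in_Hom) (use L D_Obj L0(2) L1(2) m that in auto)
  have \<pi>_sel [simp]: "l \<in> L0 \<Longrightarrow> ExoMap (\<pi> i) l = p0 i l" "l \<in> L1 \<Longrightarrow> EndoMap (\<pi> i) l = p1 i l" for i l
    unfolding \<pi>_def by simp_all
  have "is_limit J TCM D L \<pi>"
    unfolding is_limit_def
  proof (intro conjI allI impI)
    show "is_cone J TCM D L \<pi>"
      unfolding is_cone_def
    proof (intro conjI allI ballI)
      show "L \<in> Obj TCM" using L by simp
      show "\<pi> i \<in> Hom TCM L (ObjMap D i)" if "i \<in> Obj J" for i
        using \<pi>[OF that] .
      show "Comp TCM (ArrMap D k) (\<pi> i) = \<pi> j" if "k \<in> Hom J i j" for i j k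
      proof -
        have k: "k \<in> Arr J" and [simp]: "Dom J k = i" "Cod J k = j"
          using that unfolding Hom_def by auto
        have "i \<in> Obj J" "j \<in> Obj J"
          using st[OF k] by auto
        then show ?thesis
          using Comp_TCM_eq_iff[OF \<pi> _ \<pi>] D_Hom[OF k] L0(3)[OF _ k] L1(3)[OF _ k] by simp
      qed
    qed
    fix N \<rho>
    assume "is_cone J TCM D N \<rho>"
    then have \<rho>: "\<And>i. i \<in> Obj J \<Longrightarrow> \<rho> i \<in> Hom TCM N (ObjMap D i)"
      and cone: "\<And>k. k \<in> Arr J \<Longrightarrow> Comp TCM (ArrMap D k) (\<rho> (Dom J k)) = \<rho> (Cod J k)"
      and N: "is_tcm N"
      unfolding is_cone_def by (auto simp: Hom_def)
    have cone0: "ExoMap (ArrMap D k) (ExoMap (\<rho> (Dom J k)) u) = ExoMap (\<rho> (Cod J k)) u"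
      if "k \<in> Arr J" "u \<in> Exo N" for k u
      using cone[OF that(1)] Comp_TCM_sel(1)[OF \<rho> that(2)] st[OF that(1)] by metis
    have cone1: "EndoMap (ArrMap D k) (EndoMap (\<rho> (Dom J k)) v) = EndoMap (\<rho> (Cod J k)) v"
      if "k \<in> Arr J" "v \<in> Endo N" for k v
      using cone[OF that(1)] Comp_TCM_sel(2)[OF \<rho> that(2)] st[OF that(1)] by metis
    define f0 where "f0 u = lift0 (\<lambda>i. ExoMap (\<rho> i) u)" for u
    define f1 where "f1 v = lift1 (\<lambda>i. EndoMap (\<rho> i) v)" for v
    have f0: "f0 u \<in> L0 \<and> (\<forall>i\<in>Obj J. p0 i (f0 u) = ExoMap (\<rho> i) u)" if "u \<in> Exo N" for u
      unfolding f0_def by (rule L0(4)) (use Hom_TCM_D(6)[OF \<rho>] cone0 that in auto)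
    have f1: "f1 v \<in> L1 \<and> (\<forall>i\<in>Obj J. p1 i (f1 v) = EndoMap (\<rho> i) v)" if "v \<in> Endo N" for v
      unfolding f1_def by (rule L1(4)) (use Hom_TCM_D(7)[OF \<rho>] cone1 that in auto)
    define f where "f = mk_arrow N L f0 f1"
    have f: "f \<in> Hom TCM N L"
      unfolding f_def
    proof (rule mk_arrow_in_Hom)
      \<comment> \<open>The endogenous projections are jointly injective, so the square is checked
        after each of them, where it is the square of \<open>\<rho> i\<close>.\<close>
      fix u assume "u \<in> Exo N"
      then show "f1 (Mech N u) = Mech L (f0 u)"
        using f0 f1 is_tcmD(3)[OF N] m Hom_TCM_D(8)[OF \<rho>] by (intro L1(5)) auto
    qed (use L N f0 f1 in auto)
    show "\<exists>!f. f \<in> Hom TCM N L \<and> (\<forall>i\<in>Obj J. Comp TCM (\<pi> i) f = \<rho> i)"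
    proof (intro ex1I conjI ballI)
      show "f \<in> Hom TCM N L" by (fact f)
      show "Comp TCM (\<pi> i) f = \<rho> i" if "i \<in> Obj J" for i
        using Comp_TCM_eq_iff[OF f \<pi>[OF that] \<rho>[OF that]] f0 f1 that by (simp add: f_def)
      fix g
      assume g: "g \<in> Hom TCM N L \<and> (\<forall>i\<in>Obj J. Comp TCM (\<pi> i) g = \<rho> i)"
      then have gH: "g \<in> Hom TCM N L" by simp
      have g0: "ExoMap (\<pi> i) (ExoMap g u) = ExoMap (\<rho> i) u" if "i \<in> Obj J" "u \<in> Exo N" for i u
        using g that Comp_TCM_eq_iff[OF gH \<pi> \<rho>] by simp
      have g1: "EndoMap (\<pi> i) (EndoMap g v) = EndoMap (\<rho> i) v" if "i \<in> Obj J" "v \<in> Endo N" for i v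
        using g that Comp_TCM_eq_iff[OF gH \<pi> \<rho>] by simp
      show "g = f"
      proof (rule Hom_TCM_eqI[OF gH f])
        show "ExoMap g u = ExoMap f u" if "u \<in> Exo N" for u
          using Hom_TCM_D(6)[OF gH that] f0[OF that] g0[OF _ that] that
          by (intro L0(5)) (auto simp: f_def)
        show "EndoMap g v = EndoMap f v" if "v \<in> Endo N" for v
          using Hom_TCM_D(7)[OF gH that] f1[OF that] g1[OF _ that] that
          by (intro L1(5)) (auto simp: f_def)
      qed
    qed
  qed
  then show "\<exists>L \<pi>. is_limit J TCM D L \<pi>" by blast
qed

lemma TCM_has_small_colimits:
  assumes u: "universe TYPE('u)"
  shows "has_small_colimits TYPE('u) (TCM :: ('u tcm, 'u tcm_arrow) cat)"
  unfolding has_small_colimits_def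
proof (intro allI impI, elim conjE)
  fix J :: "('u, 'u) cat" and D :: "('u, 'u, 'u tcm, 'u tcm_arrow) cat_map"
  assume "small_category J" and D: "is_functor J TCM D"
  then interpret J: category J by (simp add: small_category_def)
  have I: "small (Obj J)"
    using \<open>small_category J\<close> by (simp add: small_category_def)
  have st: "Dom J k \<in> Obj J \<and> Cod J k \<in> Obj J" if "k \<in> Arr J" for k
    using that J.Dom_in_Obj J.Cod_in_Obj by blast
  have D_Obj: "is_tcm (ObjMap D i)" if "i \<in> Obj J" for i
    using D that unfolding is_functor_def by auto
  have D_small: "small (Exo (ObjMap D i))" "small (Endo (ObjMap D i))" if "i \<in> Obj J" for i
    using is_tcmD(1,2)[OF D_Obj[OF that]] .
  have D_Hom: "ArrMap D k \<in> Hom TCM (ObjMap D (Dom J k)) (ObjMap D (Cod J k))" if "k \<in> Arr J" for k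
    using D that unfolding is_functor_def by (auto simp: Hom_def)
  have "\<exists>Q \<iota> desc. is_set_colimit (Obj J) (\<lambda>i. Exo (ObjMap D i)) (Arr J) (Dom J) (Cod J)
      (\<lambda>k. ExoMap (ArrMap D k)) Q \<iota> desc"
    by (rule set_colimit_exists[OF u I]) (rule D_small(1))
  then obtain Q0 \<iota>0 desc0 where "is_set_colimit (Obj J) (\<lambda>i. Exo (ObjMap D i)) (Arr J) (Dom J) (Cod J)
      (\<lambda>k. ExoMap (ArrMap D k)) Q0 \<iota>0 desc0"
    by blast
  note Q0 = is_set_colimitD[OF this]
  have "\<exists>Q \<iota> desc. is_set_colimit (Obj J) (\<lambda>i. Endo (ObjMap D i)) (Arr J) (Dom J) (Cod J)
      (\<lambda>k. EndoMap (ArrMap D k)) Q \<iota> desc"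
    by (rule set_colimit_exists[OF u I]) (rule D_small(2))
  then obtain Q1 \<iota>1 desc1 where "is_set_colimit (Obj J) (\<lambda>i. Endo (ObjMap D i)) (Arr J) (Dom J) (Cod J)
      (\<lambda>k. EndoMap (ArrMap D k)) Q1 \<iota>1 desc1"
    by blast
  note Q1 = is_set_colimitD[OF this]
  \<comment> \<open>Each mechanism followed by the endogenous injection gives a compatible family on
    the exogenous diagram, since the arrows of the diagram commute with the mechanisms; hence it
    descends.\<close>
  define m where "m = desc0 (\<lambda>i a. \<iota>1 i (Mech (ObjMap D i) a))"
  have m: "m (\<iota>0 i a) = \<iota>1 i (Mech (ObjMap D i) a)"
    if "i \<in> Obj J" "a \<in> Exo (ObjMap D i)" for i a
    unfolding m_def
  proof (rule Q0(5)[OF _ that], intro ballI)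
    fix k a
    assume k: "k \<in> Arr J" and a: "a \<in> Exo (ObjMap D (Dom J k))"
    then show "\<iota>1 (Cod J k) (Mech (ObjMap D (Cod J k)) (ExoMap (ArrMap D k) a)) =
        \<iota>1 (Dom J k) (Mech (ObjMap D (Dom J k)) a)"
      using Hom_TCM_D(8)[OF D_Hom[OF k] a] Q1(3)[OF k] is_tcmD(3)[OF D_Obj a] st[OF k] by metis
  qed
  define Q where "Q = mk_tcm Q0 Q1 m"
  define \<iota> where "\<iota> i = mk_arrow (ObjMap D i) Q (\<iota>0 i) (\<iota>1 i)" for i
  have [simp]: "Exo Q = Q0" "Endo Q = Q1" "q \<in> Q0 \<Longrightarrow> Mech Q q = m q" for q
    unfolding Q_def by simp_all
  have Q: "is_tcm Q"
    unfolding Q_def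
  proof (rule is_tcm_mk_tcm[OF Q0(1) Q1(1)])
    fix q assume "q \<in> Q0"
    then show "m q \<in> Q1"
      using Q0(4)[of q] m Q1(2) is_tcmD(3)[OF D_Obj] by auto
  qed
  have \<iota>: "\<iota> i \<in> Hom TCM (ObjMap D i) Q" if "i \<in> Obj J" for i
    unfolding \<iota>_def by (rule mk_arrow_in_Hom) (use Q D_Obj Q0(2) Q1(2) m that in auto)
  have \<iota>_sel [simp]: "a \<in> Exo (ObjMap D i) \<Longrightarrow> ExoMap (\<iota> i) a = \<iota>0 i a"
    "a \<in> Endo (ObjMap D i) \<Longrightarrow> EndoMap (\<iota> i) a = \<iota>1 i a" for i a
    unfolding \<iota>_def by simp_all
  have "is_colimit J TCM D Q \<iota>"
    unfolding is_colimit_def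
  proof (intro conjI allI impI)
    show "is_cocone J TCM D Q \<iota>"
      unfolding is_cocone_def
    proof (intro conjI allI ballI)
      show "Q \<in> Obj TCM" using Q by simp
      show "\<iota> i \<in> Hom TCM (ObjMap D i) Q" if "i \<in> Obj J" for i
        using \<iota>[OF that] .
      show "Comp TCM (\<iota> j) (ArrMap D k) = \<iota> i" if "k \<in> Hom J i j" for i j k
      proof -
        have k: "k \<in> Arr J" and [simp]: "Dom J k = i" "Cod J k = j"
          using that unfolding Hom_def by auto
        have ij: "i \<in> Obj J" "j \<in> Obj J"
          using st[OF k] by auto
        have Dk: "ArrMap D k \<in> Hom TCM (ObjMap D i) (ObjMap D j)"
          using D_Hom[OF k] by simp
        show ?thesis
          using Comp_TCM_eq_iff[OF Dk \<iota>[OF ij(2)] \<iota>[OF ij(1)]] Hom_TCM_D(6,7)[OF Dk]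
            Q0(3)[OF k] Q1(3)[OF k] by simp
      qed
    qed
    fix N \<rho>
    assume "is_cocone J TCM D N \<rho>"
    then have \<rho>: "\<And>i. i \<in> Obj J \<Longrightarrow> \<rho> i \<in> Hom TCM (ObjMap D i) N"
      and cocone: "\<And>k. k \<in> Arr J \<Longrightarrow> Comp TCM (\<rho> (Cod J k)) (ArrMap D k) = \<rho> (Dom J k)"
      and N: "is_tcm N"
      unfolding is_cocone_def by (auto simp: Hom_def)
    have cocone0: "\<forall>k\<in>Arr J. \<forall>a\<in>Exo (ObjMap D (Dom J k)).
        ExoMap (\<rho> (Cod J k)) (ExoMap (ArrMap D k) a) = ExoMap (\<rho> (Dom J k)) a"
      using cocone Comp_TCM_sel(1)[OF D_Hom] by metis
    have cocone1: "\<forall>k\<in>Arr J. \<forall>a\<in>Endo (ObjMap D (Dom J k)).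
        EndoMap (\<rho> (Cod J k)) (EndoMap (ArrMap D k) a) = EndoMap (\<rho> (Dom J k)) a"
      using cocone Comp_TCM_sel(2)[OF D_Hom] by metis
    define f0 where "f0 = desc0 (\<lambda>i. ExoMap (\<rho> i))"
    define f1 where "f1 = desc1 (\<lambda>i. EndoMap (\<rho> i))"
    have f0: "f0 (\<iota>0 i a) = ExoMap (\<rho> i) a" if "i \<in> Obj J" "a \<in> Exo (ObjMap D i)" for i a
      unfolding f0_def by (rule Q0(5)[OF cocone0 that])
    have f1: "f1 (\<iota>1 i a) = EndoMap (\<rho> i) a" if "i \<in> Obj J" "a \<in> Endo (ObjMap D i)" for i a
      unfolding f1_def by (rule Q1(5)[OF cocone1 that])
    define f where "f = mk_arrow Q N f0 f1"
    have f: "f \<in> Hom TCM Q N"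
      unfolding f_def
    proof (rule mk_arrow_in_Hom[OF Q N])
      \<comment> \<open>\<open>desc0\<close> is controlled only on values of the injections. These
        exhaust \<open>Q0\<close>, so both the typing and the square reduce to
        representatives.\<close>
      fix q assume "q \<in> Exo Q"
      then have q: "q \<in> Q0" by simp
      then obtain i a where ia: "i \<in> Obj J" "a \<in> Exo (ObjMap D i)" "q = \<iota>0 i a"
        using Q0(4) by blast
      show "f0 q \<in> Exo N"
        using ia f0 Hom_TCM_D(6)[OF \<rho>] by simp
      show "f1 (Mech Q q) = Mech N (f0 q)"
        using ia q f0 f1 m is_tcmD(3)[OF D_Obj] Hom_TCM_D(8)[OF \<rho>] by simp
    next
      fix q assume "q \<in> Endo Q"
      then obtain i a where "i \<in> Obj J" "a \<in> Endo (ObjMap D i)" "q = \<iota>1 i a"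
        using Q1(4)[of q] by auto
      then show "f1 q \<in> Endo N"
        using f1 Hom_TCM_D(7)[OF \<rho>] by simp
    qed
    show "\<exists>!f. f \<in> Hom TCM Q N \<and> (\<forall>i\<in>Obj J. Comp TCM f (\<iota> i) = \<rho> i)"
    proof (intro ex1I conjI ballI)
      show "f \<in> Hom TCM Q N" by (fact f)
      show "Comp TCM f (\<iota> i) = \<rho> i" if "i \<in> Obj J" for i
        using Comp_TCM_eq_iff[OF \<iota>[OF that] f \<rho>[OF that]] f0 f1 Q0(2) Q1(2) that
        by (simp add: f_def)
      fix g
      assume g: "g \<in> Hom TCM Q N \<and> (\<forall>i\<in>Obj J. Comp TCM g (\<iota> i) = \<rho> i)"
      then have gH: "g \<in> Hom TCM Q N" by simp
      have g0: "ExoMap g (\<iota>0 i a) = ExoMap (\<rho> i) a" if "i \<in> Obj J" "a \<in> Exo (ObjMap D i)" for i a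
        using g that Comp_TCM_eq_iff[OF \<iota> gH \<rho>] by simp
      have g1: "EndoMap g (\<iota>1 i a) = EndoMap (\<rho> i) a" if "i \<in> Obj J" "a \<in> Endo (ObjMap D i)" for i a
        using g that Comp_TCM_eq_iff[OF \<iota> gH \<rho>] by simp
      show "g = f"
      proof (rule Hom_TCM_eqI[OF gH f])
        show "ExoMap g q = ExoMap f q" if "q \<in> Exo Q" for q
          using that Q0(4)[of q] f0 g0 by (auto simp: f_def)
        show "EndoMap g q = EndoMap f q" if "q \<in> Endo Q" for q
          using that Q1(4)[of q] f1 g1 by (auto simp: f_def)
      qed
    qed
  qed
  then show "\<exists>Q \<iota>. is_colimit J TCM D Q \<iota>" by blast
qed


section \<open>Exponentials\<close>

text \<open>\<open>pr\<close> codes a pair as one element of the universe; for an injective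
  \<open>pr\<close>, \<open>inv pr\<close> recovers the pair from its code.\<close>

definition prod_tcm :: "('u \<times> 'u \<Rightarrow> 'u) \<Rightarrow> 'u tcm \<Rightarrow> 'u tcm \<Rightarrow> 'u tcm" where
  "prod_tcm pr M N = mk_tcm (pr ` (Exo M \<times> Exo N)) (pr ` (Endo M \<times> Endo N))
     (\<lambda>z. pr (map_prod (Mech M) (Mech N) (inv pr z)))"

definition fst_tcm :: "('u \<times> 'u \<Rightarrow> 'u) \<Rightarrow> 'u tcm \<Rightarrow> 'u tcm \<Rightarrow> 'u tcm_arrow" where
  "fst_tcm pr M N = mk_arrow (prod_tcm pr M N) M (fst \<circ> inv pr) (fst \<circ> inv pr)"

definition snd_tcm :: "('u \<times> 'u \<Rightarrow> 'u) \<Rightarrow> 'u tcm \<Rightarrow> 'u tcm \<Rightarrow> 'u tcm_arrow" where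
  "snd_tcm pr M N = mk_arrow (prod_tcm pr M N) N (snd \<circ> inv pr) (snd \<circ> inv pr)"

lemma prod_tcm_sel:
  assumes "inj pr"
  shows "Exo (prod_tcm pr M N) = pr ` (Exo M \<times> Exo N)"
    "Endo (prod_tcm pr M N) = pr ` (Endo M \<times> Endo N)"
    "u \<in> Exo M \<Longrightarrow> u' \<in> Exo N \<Longrightarrow> Mech (prod_tcm pr M N) (pr (u, u')) = pr (Mech M u, Mech N u')"
    "u \<in> Exo M \<Longrightarrow> u' \<in> Exo N \<Longrightarrow> ExoMap (fst_tcm pr M N) (pr (u, u')) = u"
    "v \<in> Endo M \<Longrightarrow> v' \<in> Endo N \<Longrightarrow> EndoMap (fst_tcm pr M N) (pr (v, v')) = v"
    "u \<in> Exo M \<Longrightarrow> u' \<in> Exo N \<Longrightarrow> ExoMap (snd_tcm pr M N) (pr (u, u')) = u'"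
    "v \<in> Endo M \<Longrightarrow> v' \<in> Endo N \<Longrightarrow> EndoMap (snd_tcm pr M N) (pr (v, v')) = v'"
  unfolding prod_tcm_def fst_tcm_def snd_tcm_def using assms by simp_all

lemma TCM_product:
  fixes pr :: "'u \<times> 'u \<Rightarrow> 'u"
  assumes u: "universe TYPE('u)" and pr: "inj pr" and M: "is_tcm M" and N: "is_tcm N"
  shows "is_product TCM M N (prod_tcm pr M N) (fst_tcm pr M N) (snd_tcm pr M N)"
proof -
  have small: "small (pr ` (A \<times> B))" if "small A" "small B" for A B :: "'u set"
    using Sigma_lesspoll_universe[OF u that(1), of "\<lambda>_. B"] that(2)
    unfolding small_def by (blast intro: lesspoll_trans1 image_lepoll)
  note sel [simp] = prod_tcm_sel[OF pr]
  have P: "is_tcm (prod_tcm pr M N)"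
    unfolding prod_tcm_def
    by (rule is_tcm_mk_tcm) (use M N pr small in \<open>auto simp: is_tcmD\<close>)
  have p1: "fst_tcm pr M N \<in> Hom TCM (prod_tcm pr M N) M"
    unfolding fst_tcm_def by (rule mk_arrow_in_Hom[OF P M]) (use pr in auto)
  have p2: "snd_tcm pr M N \<in> Hom TCM (prod_tcm pr M N) N"
    unfolding snd_tcm_def by (rule mk_arrow_in_Hom[OF P N]) (use pr in auto)
  have "\<exists>!h. h \<in> Hom TCM W (prod_tcm pr M N) \<and>
      Comp TCM (fst_tcm pr M N) h = f \<and> Comp TCM (snd_tcm pr M N) h = g"
    if f: "f \<in> Hom TCM W M" and g: "g \<in> Hom TCM W N" for W f g
  proof -
    define h where "h = mk_arrow W (prod_tcm pr M N) (\<lambda>u. pr (ExoMap f u, ExoMap g u))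
      (\<lambda>v. pr (EndoMap f v, EndoMap g v))"
    have h: "h \<in> Hom TCM W (prod_tcm pr M N)"
      unfolding h_def
      by (rule mk_arrow_in_Hom) (use P Hom_TCM_D[OF f] Hom_TCM_D[OF g] in auto)
    show ?thesis
    proof (intro ex1I conjI)
      show "h \<in> Hom TCM W (prod_tcm pr M N)" by (fact h)
      show "Comp TCM (fst_tcm pr M N) h = f"
        unfolding Comp_TCM_eq_iff[OF h p1 f]
        using Hom_TCM_D[OF f] Hom_TCM_D[OF g] by (simp add: h_def)
      show "Comp TCM (snd_tcm pr M N) h = g"
        unfolding Comp_TCM_eq_iff[OF h p2 g]
        using Hom_TCM_D[OF f] Hom_TCM_D[OF g] by (simp add: h_def)
      fix k
      assume "k \<in> Hom TCM W (prod_tcm pr M N) \<and>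
        Comp TCM (fst_tcm pr M N) k = f \<and> Comp TCM (snd_tcm pr M N) k = g"
      then have k: "k \<in> Hom TCM W (prod_tcm pr M N)"
        and "Comp TCM (fst_tcm pr M N) k = f" "Comp TCM (snd_tcm pr M N) k = g"
        by blast+
      then have eqs: "\<And>u. u \<in> Exo W \<Longrightarrow> ExoMap (fst_tcm pr M N) (ExoMap k u) = ExoMap f u"
        "\<And>u. u \<in> Exo W \<Longrightarrow> ExoMap (snd_tcm pr M N) (ExoMap k u) = ExoMap g u"
        "\<And>v. v \<in> Endo W \<Longrightarrow> EndoMap (fst_tcm pr M N) (EndoMap k v) = EndoMap f v"
        "\<And>v. v \<in> Endo W \<Longrightarrow> EndoMap (snd_tcm pr M N) (EndoMap k v) = EndoMap g v"
        unfolding Comp_TCM_eq_iff[OF k p1 f] Comp_TCM_eq_iff[OF k p2 g] by blast+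
      show "k = h"
      proof (rule Hom_TCM_eqI[OF k h])
        show "ExoMap k u = ExoMap h u" if "u \<in> Exo W" for u
          using Hom_TCM_D(6)[OF k that] eqs(1,2)[OF that] that by (auto simp: h_def)
        show "EndoMap k v = EndoMap h v" if "v \<in> Endo W" for v
          using Hom_TCM_D(7)[OF k that] eqs(3,4)[OF that] that by (auto simp: h_def)
      qed
    qed
  qed
  then show ?thesis
    unfolding is_product_def using P p1 p2 by auto
qed

text \<open>An exogenous element of the exponential is a whole arrow from \<open>M\<close> to
  \<open>N\<close>, an endogenous one only a map between the endogenous parts.\<close>

lemma TCM_has_exponentials:
  assumes u: "universe TYPE('u)"
  shows "has_exponentials (TCM :: ('u tcm, 'u tcm_arrow) cat)"
  unfolding has_exponentials_def
proof
  fix M :: "'u tcm"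
  assume "M \<in> Obj TCM"
  then have M: "is_tcm M" by simp
  obtain pr :: "'u \<times> 'u \<Rightarrow> 'u" where pr: "inj pr"
    using universe_pairing[OF u] .
  note sel [simp] = prod_tcm_sel[OF pr]
  have prod: "is_product TCM M N (prod_tcm pr M N) (fst_tcm pr M N) (snd_tcm pr M N)"
    if "N \<in> Obj TCM" for N
    using TCM_product[OF u pr M] that by simp
  obtain T where T: "is_times_functor TCM M T (fst_tcm pr M) (snd_tcm pr M)"
    and T_Obj [simp]: "ObjMap T = prod_tcm pr M"
    using times_functor_exists[OF category_TCM \<open>M \<in> Obj TCM\<close> prod] by metis
  have T_functor: "is_functor TCM TCM T"
    using T unfolding is_times_functor_def by blast
  have T_Hom: "ArrMap T f \<in> Hom TCM (prod_tcm pr M N) (prod_tcm pr M N')"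
    if "f \<in> Hom TCM N N'" for f N N'
    using T_functor that unfolding is_functor_def by auto
  \<comment> \<open>The action of \<open>T\<close> on arrows is characterised only by its composites
    with the projections. Its value on a coded pair is again a coded pair, and the two projections
    determine its components.\<close>
  have T_sel:
    "u \<in> Exo M \<Longrightarrow> u' \<in> Exo N \<Longrightarrow> ExoMap (ArrMap T f) (pr (u, u')) = pr (u, ExoMap f u')"
    "v \<in> Endo M \<Longrightarrow> v' \<in> Endo N \<Longrightarrow> EndoMap (ArrMap T f) (pr (v, v')) = pr (v, EndoMap f v')"
    if f: "f \<in> Hom TCM N N'" for f N N' u u' v v'
  proof -
    have N: "is_tcm N" "is_tcm N'"
      using Hom_TCM_D[OF f] by auto
    have p: "fst_tcm pr M N \<in> Hom TCM (prod_tcm pr M N) M" "snd_tcm pr M N \<in> Hom TCM (prod_tcm pr M N) N"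
      "fst_tcm pr M N' \<in> Hom TCM (prod_tcm pr M N') M" "snd_tcm pr M N' \<in> Hom TCM (prod_tcm pr M N') N'"
      using prod[of N] prod[of N'] N unfolding is_product_def by auto
    have "Comp TCM (fst_tcm pr M N') (ArrMap T f) = fst_tcm pr M N"
      "Comp TCM (snd_tcm pr M N') (ArrMap T f) = Comp TCM f (snd_tcm pr M N)"
      using T f unfolding is_times_functor_def by blast+
    note eqs = this[unfolded Comp_TCM_eq_iff[OF T_Hom[OF f] p(3) p(1)]
        Comp_TCM_eq_iff[OF T_Hom[OF f] p(4) Comp_TCM_in_Hom[OF p(2) f]]]
    {
      assume u: "u \<in> Exo M" "u' \<in> Exo N"
      then have "ExoMap (fst_tcm pr M N') (ExoMap (ArrMap T f) (pr (u, u'))) = u"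
        "ExoMap (snd_tcm pr M N') (ExoMap (ArrMap T f) (pr (u, u'))) = ExoMap f u'"
        using eqs by (simp_all add: Comp_TCM_sel[OF p(2)])
      moreover have "ExoMap (ArrMap T f) (pr (u, u')) \<in> pr ` (Exo M \<times> Exo N')"
        using Hom_TCM_D(6)[OF T_Hom[OF f], of "pr (u, u')"] u by simp
      ultimately
      show "ExoMap (ArrMap T f) (pr (u, u')) = pr (u, ExoMap f u')"
        by auto
    next
      assume v: "v \<in> Endo M" "v' \<in> Endo N"
      then have "EndoMap (fst_tcm pr M N') (EndoMap (ArrMap T f) (pr (v, v'))) = v"
        "EndoMap (snd_tcm pr M N') (EndoMap (ArrMap T f) (pr (v, v'))) = EndoMap f v'"
        using eqs by (simp_all add: Comp_TCM_sel[OF p(2)])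
      moreover have "EndoMap (ArrMap T f) (pr (v, v')) \<in> pr ` (Endo M \<times> Endo N')"
        using Hom_TCM_D(7)[OF T_Hom[OF f], of "pr (v, v')"] v by simp
      ultimately
      show "EndoMap (ArrMap T f) (pr (v, v')) = pr (v, EndoMap f v')"
        by auto
    }
  qed
  have "has_right_adjoint TCM TCM T"
  proof (rule has_right_adjointI[OF T_functor])
    fix N :: "'u tcm"
    assume "N \<in> Obj TCM"
    then have N: "is_tcm N" by simp
    define G where "G = Endo M \<rightarrow>\<^sub>E Endo N"
    define H where "H = {(a, b) \<in> (Exo M \<rightarrow>\<^sub>E Exo N) \<times> G. \<forall>u\<in>Exo M. b (Mech M u) = Mech N (a u)}"
    have G_small: "G \<prec> (UNIV :: 'u set)"
      unfolding G_def by (intro PiE_lesspoll_universe[OF u] is_tcmD M N)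
    have "(Exo M \<rightarrow>\<^sub>E Exo N) \<times> G \<prec> (UNIV :: 'u set)"
      by (intro Times_lesspoll_universe[OF u] PiE_lesspoll_universe[OF u] is_tcmD M N G_small)
    moreover have "H \<lesssim> (Exo M \<rightarrow>\<^sub>E Exo N) \<times> G"
      unfolding H_def by (rule subset_imp_lepoll) blast
    ultimately have H_small: "H \<prec> (UNIV :: 'u set)"
      by (rule lesspoll_trans1[rotated])
    obtain e0 :: "('u \<Rightarrow> 'u) \<times> ('u \<Rightarrow> 'u) \<Rightarrow> 'u" and d0
      where e0: "small (e0 ` H)" "\<And>x. x \<in> H \<Longrightarrow> d0 (e0 x) = x"
      using small_code[OF H_small] by blast
    obtain e1 :: "('u \<Rightarrow> 'u) \<Rightarrow> 'u" and d1
      where e1: "small (e1 ` G)" "\<And>x. x \<in> G \<Longrightarrow> d1 (e1 x) = x"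
      using small_code[OF G_small] by blast
    \<comment> \<open>The mechanism forgets the exogenous component of an arrow and keeps the
      endogenous one.\<close>
    define E where "E = mk_tcm (e0 ` H) (e1 ` G) (\<lambda>e. e1 (snd (d0 e)))"
    have E_sel [simp]: "Exo E = e0 ` H" "Endo E = e1 ` G"
      "\<And>x. x \<in> H \<Longrightarrow> Mech E (e0 x) = e1 (snd x)"
      using e0(2) unfolding E_def by simp_all
    have snd_H: "snd x \<in> G" if "x \<in> H" for x
      using that unfolding H_def by auto
    have E: "is_tcm E"
      unfolding E_def by (rule is_tcm_mk_tcm[OF e0(1) e1(1)]) (use e0(2) snd_H in auto)
    \<comment> \<open>Evaluation, with both codings undone. The condition defining \<open>H\<close>
      is exactly its compatibility with the mechanisms.\<close>
    define \<epsilon> where "\<epsilon> = mk_arrow (prod_tcm pr M E) N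
      (\<lambda>z. fst (d0 (snd (inv pr z))) (fst (inv pr z))) (\<lambda>z. d1 (snd (inv pr z)) (fst (inv pr z)))"
    have \<epsilon>_sel [simp]: "\<And>u x. u \<in> Exo M \<Longrightarrow> x \<in> H \<Longrightarrow> ExoMap \<epsilon> (pr (u, e0 x)) = fst x u"
      "\<And>v y. v \<in> Endo M \<Longrightarrow> y \<in> G \<Longrightarrow> EndoMap \<epsilon> (pr (v, e1 y)) = y v"
      unfolding \<epsilon>_def using pr e0(2) e1(2) by simp_all
    have P: "is_tcm (prod_tcm pr M E)"
      using prod[of E] E unfolding is_product_def by simp
    have \<epsilon>: "\<epsilon> \<in> Hom TCM (prod_tcm pr M E) N"
      unfolding \<epsilon>_def
      by (rule mk_arrow_in_Hom[OF P N])
        (use pr e0(2) e1(2) snd_H is_tcmD(3)[OF M] in \<open>auto simp: H_def G_def\<close>)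
    have "\<exists>!g. g \<in> Hom TCM C E \<and> Comp TCM \<epsilon> (ArrMap T g) = f"
      if C: "is_tcm C" and f: "f \<in> Hom TCM (prod_tcm pr M C) N" for C f
    proof -
      have eval_iff: "Comp TCM \<epsilon> (ArrMap T g) = f \<longleftrightarrow>
          (\<forall>u\<in>Exo M. \<forall>c\<in>Exo C. ExoMap \<epsilon> (pr (u, ExoMap g c)) = ExoMap f (pr (u, c))) \<and>
          (\<forall>v\<in>Endo M. \<forall>c\<in>Endo C. EndoMap \<epsilon> (pr (v, EndoMap g c)) = EndoMap f (pr (v, c)))"
        if g: "g \<in> Hom TCM C E" for g
        unfolding Comp_TCM_eq_iff[OF T_Hom[OF g] \<epsilon> f] by (auto simp: T_sel[OF g])
      \<comment> \<open>Currying \<open>f\<close>. The endogenous half of \<open>k0 c\<close> must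
        be the curried map at \<open>Mech C c\<close>, since the mechanism of \<open>E\<close> keeps
        just that half and the transpose has to commute with mechanisms.\<close>
      define k0 where "k0 c = (\<lambda>u\<in>Exo M. ExoMap f (pr (u, c)), \<lambda>v\<in>Endo M. EndoMap f (pr (v, Mech C c)))" for c
      define k1 where "k1 c = (\<lambda>v\<in>Endo M. EndoMap f (pr (v, c)))" for c
      have k1: "k1 c \<in> G" if "c \<in> Endo C" for c
        using Hom_TCM_D(7)[OF f] that unfolding k1_def G_def by auto
      have k0: "k0 c \<in> H" if "c \<in> Exo C" for c
      proof -
        have "EndoMap f (pr (Mech M u, Mech C c)) = Mech N (ExoMap f (pr (u, c)))" if "u \<in> Exo M" for u
          using Hom_TCM_D(8)[OF f, of "pr (u, c)"] that \<open>c \<in> Exo C\<close> by simp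
        moreover have "(\<lambda>u\<in>Exo M. ExoMap f (pr (u, c))) \<in> Exo M \<rightarrow>\<^sub>E Exo N"
          using Hom_TCM_D(6)[OF f] that by auto
        ultimately show ?thesis
          using k1[OF is_tcmD(3)[OF C that]] is_tcmD(3)[OF M] unfolding H_def k0_def k1_def by simp
      qed
      define g where "g = mk_arrow C E (\<lambda>c. e0 (k0 c)) (\<lambda>c. e1 (k1 c))"
      have g: "g \<in> Hom TCM C E"
        unfolding g_def by (rule mk_arrow_in_Hom[OF C E]) (use k0 k1 in \<open>auto simp: k0_def k1_def\<close>)
      have g_eval: "Comp TCM \<epsilon> (ArrMap T g) = f"
        \<comment> \<open>\<open>k0\<close> and \<open>k1\<close> stay folded at first, so that
          \<open>\<epsilon>_sel\<close> applies to them as members of \<open>H\<close> and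
          \<open>G\<close>; only then are their values computed.\<close>
        unfolding eval_iff[OF g] using k0 k1 by (simp add: g_def) (simp add: k0_def k1_def)
      show ?thesis
      proof (intro ex1I conjI)
        show "g \<in> Hom TCM C E" "Comp TCM \<epsilon> (ArrMap T g) = f"
          by (fact g, fact g_eval)
        fix h
        assume "h \<in> Hom TCM C E \<and> Comp TCM \<epsilon> (ArrMap T h) = f"
        then have h: "h \<in> Hom TCM C E" and "Comp TCM \<epsilon> (ArrMap T h) = f" by auto
        then have h0: "\<And>u c. u \<in> Exo M \<Longrightarrow> c \<in> Exo C \<Longrightarrow> ExoMap \<epsilon> (pr (u, ExoMap h c)) = ExoMap f (pr (u, c))"
          and h1: "\<And>v c. v \<in> Endo M \<Longrightarrow> c \<in> Endo C \<Longrightarrow> EndoMap \<epsilon> (pr (v, EndoMap h c)) = EndoMap f (pr (v, c))"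
          using eval_iff[OF h] by auto
        have h_Endo: "EndoMap h c = e1 (k1 c)" if c: "c \<in> Endo C" for c
        proof -
          obtain y where y: "y \<in> G" "EndoMap h c = e1 y"
            using Hom_TCM_D(7)[OF h c] by auto
          have "y = k1 c"
            using y h1[OF _ c] k1[OF c] unfolding G_def
            by (intro PiE_ext[of y "Endo M" "\<lambda>_. Endo N" "k1 c"]) (auto simp: k1_def G_def)
          with y show ?thesis by simp
        qed
        have h_Exo: "ExoMap h c = e0 (k0 c)" if c: "c \<in> Exo C" for c
        proof -
          obtain x where x: "x \<in> H" "ExoMap h c = e0 x"
            using Hom_TCM_D(6)[OF h c] by auto
          have "fst x = fst (k0 c)"
            using x h0[OF _ c] k0[OF c]
            by (intro PiE_ext[of "fst x" "Exo M" "\<lambda>_. Exo N" "fst (k0 c)"]) (auto simp: k0_def H_def)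
          \<comment> \<open>On exogenous elements evaluation tests only the first half of
            \<open>x\<close>. The second is forced by the mechanism square of \<open>h\<close> and
            the endogenous uniqueness \<open>h_Endo\<close>.\<close>
          moreover have "e1 (snd x) = e1 (k1 (Mech C c))"
            using Hom_TCM_D(8)[OF h c] h_Endo[OF is_tcmD(3)[OF C c]] x by simp
          then have "snd x = snd (k0 c)"
            using e1(2)[OF snd_H[OF x(1)]] e1(2)[OF k1[OF is_tcmD(3)[OF C c]]]
            by (simp add: k0_def k1_def)
          ultimately have "x = k0 c"
            by (rule prod_eqI)
          with x(2) show ?thesis by simp
        qed
        show "h = g"
          by (rule Hom_TCM_eqI[OF h g]) (simp_all add: h_Exo h_Endo g_def)
      qed
    qed
    then show "\<exists>E \<epsilon>. E \<in> Obj TCM \<and> \<epsilon> \<in> Hom TCM (ObjMap T E) N \<and>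
        (\<forall>C\<in>Obj TCM. \<forall>f\<in>Hom TCM (ObjMap T C) N.
          \<exists>!g. g \<in> Hom TCM C E \<and> Comp TCM \<epsilon> (ArrMap T g) = f)"
      using E \<epsilon> by (intro exI[of _ E] exI[of _ \<epsilon>]) simp
  qed
  then show "\<exists>T \<pi>1 \<pi>2. is_times_functor TCM M T \<pi>1 \<pi>2 \<and> has_right_adjoint TCM TCM T"
    using T by blast
qed


section \<open>Subobject classifier\<close>

text \<open>Arrows out of these two models pick out the exogenous, respectively endogenous, elements
  of a model.\<close>

definition exo_point :: "'u \<Rightarrow> 'u tcm" where
  "exo_point z = mk_tcm {z} {z} id"

definition endo_point :: "'u \<Rightarrow> 'u tcm" where
  "endo_point z = mk_tcm {} {z} id"

lemma point_sel [simp]: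
  "Exo (exo_point z) = {z}" "Endo (exo_point z) = {z}" "Mech (exo_point z) z = z"
  "Exo (endo_point z) = {}" "Endo (endo_point z) = {z}"
  unfolding exo_point_def endo_point_def by simp_all

lemma is_tcm_point:
  fixes z :: 'u
  assumes "universe TYPE('u)"
  shows "is_tcm (exo_point z)" "is_tcm (endo_point z)"
  unfolding exo_point_def endo_point_def by (intro is_tcm_mk_tcm small_finite[OF assms]; simp)+

lemma exo_point_Hom:
  fixes M :: "'u tcm"
  assumes "universe TYPE('u)" "is_tcm M" "u \<in> Exo M"
  shows "mk_arrow (exo_point z) M (\<lambda>_. u) (\<lambda>_. Mech M u) \<in> Hom TCM (exo_point z) M"
  by (rule mk_arrow_in_Hom) (use assms is_tcm_point[OF assms(1)] in \<open>auto simp: is_tcmD\<close>)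

lemma endo_point_Hom:
  fixes M :: "'u tcm"
  assumes "universe TYPE('u)" "is_tcm M" "v \<in> Endo M"
  shows "mk_arrow (endo_point z) M id (\<lambda>_. v) \<in> Hom TCM (endo_point z) M"
  by (rule mk_arrow_in_Hom) (use assms is_tcm_point[OF assms(1)] in auto)

text \<open>The same model thus plays two roles: source of truth in the classifier and test object
  for exogenous elements.\<close>

lemma exo_point_terminal:
  fixes z :: 'u
  assumes "universe TYPE('u)"
  shows "is_terminal TCM (exo_point z)"
  unfolding is_terminal_def
proof (intro conjI ballI)
  show "exo_point z \<in> Obj TCM"
    using is_tcm_point[OF assms] by simp
  fix M :: "'u tcm"
  assume "M \<in> Obj TCM"
  then have h: "mk_arrow M (exo_point z) (\<lambda>_. z) (\<lambda>_. z) \<in> Hom TCM M (exo_point z)"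
    using is_tcm_point[OF assms] by (intro mk_arrow_in_Hom) auto
  then show "\<exists>!f. f \<in> Hom TCM M (exo_point z)"
  proof (rule ex1I)
    fix g assume g: "g \<in> Hom TCM M (exo_point z)"
    show "g = mk_arrow M (exo_point z) (\<lambda>_. z) (\<lambda>_. z)"
      by (rule Hom_TCM_eqI[OF g h]) (use Hom_TCM_D(6,7)[OF g] in auto)
  qed
qed

text \<open>Elements are arrows out of points, so cancelling \<open>m\<close> against such arrows is
  injectivity. \<open>endo_point\<close> is required for the endogenous part because arrows out of
  \<open>exo_point\<close> reach only the endogenous elements in the image of the mechanism.\<close>

lemma monic_TCM_inj:
  fixes m :: "'u tcm_arrow"
  assumes u: "universe TYPE('u)" and m: "m \<in> Hom TCM S X" and "is_monic TCM m"
  shows "inj_on (ExoMap m) (Exo S)" "inj_on (EndoMap m) (Endo S)"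
proof -
  have S: "is_tcm S"
    using Hom_TCM_D[OF m] by simp
  have cancel: "f = g" if "f \<in> Hom TCM W S" "g \<in> Hom TCM W S" "Comp TCM m f = Comp TCM m g" for W f g
    using assms(3) that Hom_TCM_D(2)[OF m] unfolding is_monic_def by auto
  \<comment> \<open>An arbitrary element of the universe, to name the single element of the test
    points.\<close>
  obtain z :: 'u where True by blast
  show "inj_on (ExoMap m) (Exo S)"
  proof (rule inj_onI)
    fix a b
    assume ab: "a \<in> Exo S" "b \<in> Exo S" and eq: "ExoMap m a = ExoMap m b"
    let ?f = "\<lambda>a. mk_arrow (exo_point z) S (\<lambda>_. a) (\<lambda>_. Mech S a)"
    note f = exo_point_Hom[OF u S ab(1), of z] exo_point_Hom[OF u S ab(2), of z]
    have "Comp TCM m (?f a) = Comp TCM m (?f b)"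
      by (rule Hom_TCM_eqI[OF Comp_TCM_in_Hom[OF f(1) m] Comp_TCM_in_Hom[OF f(2) m]])
        (use ab eq Hom_TCM_D(8)[OF m] in \<open>simp_all add: Comp_TCM_sel[OF f(1)] Comp_TCM_sel[OF f(2)]\<close>)
    then have "ExoMap (?f a) z = ExoMap (?f b) z"
      using cancel[OF f] by simp
    then show "a = b" by simp
  qed
  show "inj_on (EndoMap m) (Endo S)"
  proof (rule inj_onI)
    fix a b
    assume ab: "a \<in> Endo S" "b \<in> Endo S" and eq: "EndoMap m a = EndoMap m b"
    let ?f = "\<lambda>a. mk_arrow (endo_point z) S id (\<lambda>_. a)"
    note f = endo_point_Hom[OF u S ab(1), of z] endo_point_Hom[OF u S ab(2), of z]
    have "Comp TCM m (?f a) = Comp TCM m (?f b)"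
      by (rule Hom_TCM_eqI[OF Comp_TCM_in_Hom[OF f(1) m] Comp_TCM_in_Hom[OF f(2) m]])
        (use eq in \<open>simp_all add: Comp_TCM_sel[OF f(1)] Comp_TCM_sel[OF f(2)]\<close>)
    then have "EndoMap (?f a) z = EndoMap (?f b) z"
      using cancel[OF f] by simp
    then show "a = b" by simp
  qed
qed

text \<open>Forwards, points of \<open>X\<close> over truth are tested against the universal
  property. Backwards, an arrow into the fibres factors through the injective \<open>m\<close> by
  taking preimages, and the leg into the terminal model commutes automatically. Existence and
  uniqueness of the characteristic arrow thereby become statements about values.\<close>

lemma pullback_of_point_iff:
  fixes m \<phi> b tru :: "'u tcm_arrow" and z :: 'u
  assumes u: "universe TYPE('u)" and m: "m \<in> Hom TCM S X"
    and inj: "inj_on (ExoMap m) (Exo S)" "inj_on (EndoMap m) (Endo S)"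
    and b: "b \<in> Hom TCM S (exo_point z)" and tru: "tru \<in> Hom TCM (exo_point z) \<Omega>"
    and \<phi>: "\<phi> \<in> Hom TCM X \<Omega>"
  shows "is_pullback TCM \<phi> tru m b \<longleftrightarrow>
    (\<forall>u\<in>Exo X. ExoMap \<phi> u = ExoMap tru z \<longleftrightarrow> u \<in> ExoMap m ` Exo S) \<and>
    (\<forall>v\<in>Endo X. EndoMap \<phi> v = EndoMap tru z \<longleftrightarrow> v \<in> EndoMap m ` Endo S)"
    (is "_ \<longleftrightarrow> ?rhs")
proof
  note X = Hom_TCM_D(5)[OF m]
  have sel: "Dom TCM \<phi> = X" "Dom TCM tru = exo_point z" "Dom TCM m = S"
    using Hom_TCM_D(2)[OF \<phi>] Hom_TCM_D(2)[OF tru] Hom_TCM_D(2)[OF m] by simp_all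
  assume pb: "is_pullback TCM \<phi> tru m b"
  then have comm: "Comp TCM \<phi> m = Comp TCM tru b"
    unfolding is_pullback_def by blast
  have factor: "\<exists>h. h \<in> Hom TCM W S \<and> Comp TCM m h = f"
    if "f \<in> Hom TCM W X" "g \<in> Hom TCM W (exo_point z)" "Comp TCM \<phi> f = Comp TCM tru g" for W f g
    using pb that unfolding is_pullback_def sel by blast
  show ?rhs
  proof (intro conjI ballI iffI)
    fix u assume "u \<in> ExoMap m ` Exo S"
    then obtain s where s: "s \<in> Exo S" "u = ExoMap m s" by blast
    have "ExoMap \<phi> (ExoMap m s) = ExoMap tru (ExoMap b s)"
      using arg_cong[OF comm, of "\<lambda>f. ExoMap f s"] s by (simp add: Comp_TCM_sel[OF m] Comp_TCM_sel[OF b])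
    then show "ExoMap \<phi> u = ExoMap tru z"
      using s Hom_TCM_D(6)[OF b] by simp
  next
    fix v assume "v \<in> EndoMap m ` Endo S"
    then obtain s where s: "s \<in> Endo S" "v = EndoMap m s" by blast
    have "EndoMap \<phi> (EndoMap m s) = EndoMap tru (EndoMap b s)"
      using arg_cong[OF comm, of "\<lambda>f. EndoMap f s"] s by (simp add: Comp_TCM_sel[OF m] Comp_TCM_sel[OF b])
    then show "EndoMap \<phi> v = EndoMap tru z"
      using s Hom_TCM_D(7)[OF b] by simp
  next
    fix x assume x: "x \<in> Exo X" and eq: "ExoMap \<phi> x = ExoMap tru z"
    let ?f = "mk_arrow (exo_point z) X (\<lambda>_. x) (\<lambda>_. Mech X x)"
    note f = exo_point_Hom[OF u X x, of z]
    have I: "Id TCM (exo_point z) \<in> Hom TCM (exo_point z) (exo_point z)"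
      by (intro Id_TCM_in_Hom is_tcm_point u)
    \<comment> \<open>Exogenous truth forces endogenous truth: apply the mechanism of
      \<open>\<Omega>\<close> to \<open>eq\<close> and use that \<open>\<phi>\<close> and
      \<open>tru\<close> commute with mechanisms.\<close>
    have "EndoMap \<phi> (Mech X x) = EndoMap tru z"
      using Hom_TCM_D(8)[OF \<phi> x] Hom_TCM_D(8)[OF tru] eq by simp
    then have "Comp TCM \<phi> ?f = Comp TCM tru (Id TCM (exo_point z))"
      by (intro Hom_TCM_eqI[OF Comp_TCM_in_Hom[OF f \<phi>] Comp_TCM_in_Hom[OF I tru]])
        (use eq in \<open>simp_all add: Comp_TCM_sel[OF f] Comp_TCM_sel[OF I] Id_TCM_sel\<close>)
    then obtain h where h: "h \<in> Hom TCM (exo_point z) S" "Comp TCM m h = ?f"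
      using factor[OF f I] by blast
    then have "ExoMap m (ExoMap h z) = x"
      using Comp_TCM_sel(1)[OF h(1), of z m] by simp
    then show "x \<in> ExoMap m ` Exo S"
      using Hom_TCM_D(6)[OF h(1)] by force
  next
    fix x assume x: "x \<in> Endo X" and eq: "EndoMap \<phi> x = EndoMap tru z"
    let ?f = "mk_arrow (endo_point z) X id (\<lambda>_. x)"
    note f = endo_point_Hom[OF u X x, of z]
    have I: "mk_arrow (endo_point z) (exo_point z) id (\<lambda>_. z) \<in> Hom TCM (endo_point z) (exo_point z)"
      by (intro endo_point_Hom is_tcm_point u) simp
    have "Comp TCM \<phi> ?f = Comp TCM tru (mk_arrow (endo_point z) (exo_point z) id (\<lambda>_. z))"
      by (intro Hom_TCM_eqI[OF Comp_TCM_in_Hom[OF f \<phi>] Comp_TCM_in_Hom[OF I tru]])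
        (use eq in \<open>simp_all add: Comp_TCM_sel[OF f] Comp_TCM_sel[OF I]\<close>)
    then obtain h where h: "h \<in> Hom TCM (endo_point z) S" "Comp TCM m h = ?f"
      using factor[OF f I] by blast
    then have "EndoMap m (EndoMap h z) = x"
      using Comp_TCM_sel(2)[OF h(1), of z m] by simp
    then show "x \<in> EndoMap m ` Endo S"
      using Hom_TCM_D(7)[OF h(1)] by force
  qed
next
  assume rhs: ?rhs
  have to_point: "f = g" if "f \<in> Hom TCM W (exo_point z)" "g \<in> Hom TCM W (exo_point z)" for f g W
    using that Hom_TCM_D(6,7)[OF that(1)] Hom_TCM_D(6,7)[OF that(2)]
    by (intro Hom_TCM_eqI[OF that]) auto
  show "is_pullback TCM \<phi> tru m b"
    unfolding is_pullback_def
  proof (intro conjI allI ballI impI)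
    show "\<phi> \<in> Arr TCM" "tru \<in> Arr TCM" "m \<in> Arr TCM" "b \<in> Arr TCM" "Cod TCM \<phi> = Cod TCM tru"
      "Dom TCM m = Dom TCM b" "Cod TCM m = Dom TCM \<phi>" "Cod TCM b = Dom TCM tru"
      using Hom_TCM_D(1-3)[OF \<phi>] Hom_TCM_D(1-3)[OF tru] Hom_TCM_D(1-3)[OF m] Hom_TCM_D(1-3)[OF b]
      by simp_all
    show "Comp TCM \<phi> m = Comp TCM tru b"
      by (rule Hom_TCM_eqI[OF Comp_TCM_in_Hom[OF m \<phi>] Comp_TCM_in_Hom[OF b tru]])
        (use rhs Hom_TCM_D(6,7)[OF m] Hom_TCM_D(6,7)[OF b] in
          \<open>simp_all add: Comp_TCM_sel[OF m] Comp_TCM_sel[OF b]\<close>)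
    fix W f g
    assume f': "f \<in> Hom TCM W (Dom TCM \<phi>)" and g': "g \<in> Hom TCM W (Dom TCM tru)"
      and comm: "Comp TCM \<phi> f = Comp TCM tru g"
    have f: "f \<in> Hom TCM W X" and g: "g \<in> Hom TCM W (exo_point z)"
      using f' g' Hom_TCM_D(2)[OF \<phi>] Hom_TCM_D(2)[OF tru] by simp_all
    have f0: "ExoMap f w \<in> ExoMap m ` Exo S" if "w \<in> Exo W" for w
    proof -
      have "ExoMap \<phi> (ExoMap f w) = ExoMap tru z"
        using arg_cong[OF comm, of "\<lambda>f. ExoMap f w"] that Hom_TCM_D(6)[OF g]
        by (simp add: Comp_TCM_sel[OF f] Comp_TCM_sel[OF g])
      then show ?thesis
        using rhs Hom_TCM_D(6)[OF f that] by blast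
    qed
    have f1: "EndoMap f w \<in> EndoMap m ` Endo S" if "w \<in> Endo W" for w
    proof -
      have "EndoMap \<phi> (EndoMap f w) = EndoMap tru z"
        using arg_cong[OF comm, of "\<lambda>f. EndoMap f w"] that Hom_TCM_D(7)[OF g]
        by (simp add: Comp_TCM_sel[OF f] Comp_TCM_sel[OF g])
      then show ?thesis
        using rhs Hom_TCM_D(7)[OF f that] by blast
    qed
    define k0 where "k0 w = inv_into (Exo S) (ExoMap m) (ExoMap f w)" for w
    define k1 where "k1 w = inv_into (Endo S) (EndoMap m) (EndoMap f w)" for w
    have k0: "k0 w \<in> Exo S" "ExoMap m (k0 w) = ExoMap f w" if "w \<in> Exo W" for w
      using f0[OF that] unfolding k0_def by (auto intro: inv_into_into f_inv_into_f)
    have k1: "k1 w \<in> Endo S" "EndoMap m (k1 w) = EndoMap f w" if "w \<in> Endo W" for w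
      using f1[OF that] unfolding k1_def by (auto intro: inv_into_into f_inv_into_f)
    define h where "h = mk_arrow W S k0 k1"
    have h: "h \<in> Hom TCM W S"
      unfolding h_def
    proof (rule mk_arrow_in_Hom)
      show W: "is_tcm W" and S: "is_tcm S"
        using Hom_TCM_D(4)[OF f] Hom_TCM_D(4)[OF m] .
      show "k0 w \<in> Exo S" if "w \<in> Exo W" for w using k0[OF that] by simp
      show "k1 w \<in> Endo S" if "w \<in> Endo W" for w using k1[OF that] by simp
      \<comment> \<open>The preimages were chosen separately in the two components. They match
        because \<open>m\<close> is endogenously injective and \<open>f\<close> and \<open>m\<close>
        commute with the mechanisms.\<close>
      show "k1 (Mech W w) = Mech S (k0 w)" if w: "w \<in> Exo W" for w
      proof (rule inj_onD[OF inj(2)])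
        show "k1 (Mech W w) \<in> Endo S" "Mech S (k0 w) \<in> Endo S"
          using k0(1)[OF w] k1(1) is_tcmD(3)[OF W w] is_tcmD(3)[OF S] by auto
        show "EndoMap m (k1 (Mech W w)) = EndoMap m (Mech S (k0 w))"
          using k0[OF w] k1(2)[OF is_tcmD(3)[OF W w]] Hom_TCM_D(8)[OF f w] Hom_TCM_D(8)[OF m]
          by simp
      qed
    qed
    show "\<exists>!h. h \<in> Hom TCM W (Dom TCM m) \<and> Comp TCM m h = f \<and> Comp TCM b h = g"
    proof (intro ex1I conjI)
      show "h \<in> Hom TCM W (Dom TCM m)"
        using h Hom_TCM_D(2)[OF m] by simp
      show "Comp TCM m h = f"
        unfolding Comp_TCM_eq_iff[OF h m f] using k0 k1 by (simp add: h_def)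
      show "Comp TCM b h = g"
        by (rule to_point[OF Comp_TCM_in_Hom[OF h b] g])
      fix k
      assume "k \<in> Hom TCM W (Dom TCM m) \<and> Comp TCM m k = f \<and> Comp TCM b k = g"
      then have k: "k \<in> Hom TCM W S" and mk: "Comp TCM m k = f"
        using Hom_TCM_D(2)[OF m] by auto
      show "k = h"
      proof (rule Hom_TCM_eqI[OF k h])
        show "ExoMap k w = ExoMap h w" if "w \<in> Exo W" for w
          using mk that k0[OF that] Hom_TCM_D(6)[OF k that] unfolding Comp_TCM_eq_iff[OF k m f]
          by - (rule inj_onD[OF inj(1)], auto simp: h_def)
        show "EndoMap k w = EndoMap h w" if "w \<in> Endo W" for w
          using mk that k1[OF that] Hom_TCM_D(7)[OF k that] unfolding Comp_TCM_eq_iff[OF k m f]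
          by - (rule inj_onD[OF inj(2)], auto simp: h_def)
      qed
    qed
  qed
qed

text \<open>Endogenously there are two truth values, \<open>f\<close> and \<open>t\<close>; the third exogenous
  value \<open>e\<close> marks the elements outside the subobject whose image under the mechanism
  lies inside it.\<close>

lemma TCM_has_subobject_classifier:
  assumes u: "universe TYPE('u)"
  shows "has_subobject_classifier (TCM :: ('u tcm, 'u tcm_arrow) cat)"
proof -
  note inf = universe_infinite[OF u]
  obtain f :: 'u where True by blast
  obtain e :: 'u where "e \<notin> {f}"
    using ex_new_if_finite[OF inf, of "{f}"] by auto
  moreover obtain t :: 'u where "t \<notin> {f, e}"
    using ex_new_if_finite[OF inf, of "{f, e}"] by auto
  ultimately have distinct [simp]: "e \<noteq> f" "f \<noteq> e" "t \<noteq> f" "f \<noteq> t" "t \<noteq> e" "e \<noteq> t"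
    by auto
  define \<Omega> where "\<Omega> = mk_tcm {f, e, t} {f, t} (\<lambda>x. if x = f then f else t)"
  have \<Omega>_sel [simp]: "Exo \<Omega> = {f, e, t}" "Endo \<Omega> = {f, t}"
    "\<And>x. x \<in> {f, e, t} \<Longrightarrow> Mech \<Omega> x = (if x = f then f else t)"
    unfolding \<Omega>_def by simp_all
  have \<Omega>: "is_tcm \<Omega>"
    unfolding \<Omega>_def by (rule is_tcm_mk_tcm) (auto intro: small_finite[OF u])
  define tru where "tru = mk_arrow (exo_point t) \<Omega> id id"
  have tru: "tru \<in> Hom TCM (exo_point t) \<Omega>"
    unfolding tru_def by (rule mk_arrow_in_Hom) (use \<Omega> is_tcm_point[OF u] in auto)
  have tru_sel: "ExoMap tru t = t" "EndoMap tru t = t"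
    unfolding tru_def by simp_all
  have "\<exists>!\<phi>. \<phi> \<in> Hom TCM X \<Omega> \<and> is_pullback TCM \<phi> tru m b"
    if m: "m \<in> Hom TCM S X" and b: "b \<in> Hom TCM S (exo_point t)" and monic: "is_monic TCM m" for S X m b
  proof -
    note X = Hom_TCM_D(5)[OF m]
    note pb_iff = pullback_of_point_iff[OF u m monic_TCM_inj[OF u m monic] b tru, unfolded tru_sel]
    define \<phi> where "\<phi> = mk_arrow X \<Omega>
      (\<lambda>x. if x \<in> ExoMap m ` Exo S then t else if Mech X x \<in> EndoMap m ` Endo S then e else f)
      (\<lambda>x. if x \<in> EndoMap m ` Endo S then t else f)"
    \<comment> \<open>An exogenous element of the subobject has its mechanism image in the subobject
      as well, so value \<open>t\<close> is never paired with endogenous value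
      \<open>f\<close>.\<close>
    have m_Mech: "Mech X x \<in> EndoMap m ` Endo S" if x: "x \<in> ExoMap m ` Exo S" for x
    proof -
      obtain s where s: "s \<in> Exo S" "x = ExoMap m s" using x by blast
      then have "Mech X x = EndoMap m (Mech S s)"
        using Hom_TCM_D(8)[OF m] by simp
      then show ?thesis
        using is_tcmD(3)[OF Hom_TCM_D(4)[OF m] s(1)] by blast
    qed
    have \<phi>: "\<phi> \<in> Hom TCM X \<Omega>"
      unfolding \<phi>_def by (rule mk_arrow_in_Hom[OF X \<Omega>]) (use m_Mech in auto)
    show ?thesis
    proof (intro ex1I conjI)
      show "\<phi> \<in> Hom TCM X \<Omega>" by (fact \<phi>)
      show "is_pullback TCM \<phi> tru m b"
        unfolding pb_iff[OF \<phi>] by (simp add: \<phi>_def)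
      fix \<psi>
      assume "\<psi> \<in> Hom TCM X \<Omega> \<and> is_pullback TCM \<psi> tru m b"
      then have \<psi>: "\<psi> \<in> Hom TCM X \<Omega>" and "is_pullback TCM \<psi> tru m b"
        by blast+
      then have exo: "\<And>x. x \<in> Exo X \<Longrightarrow> ExoMap \<psi> x = t \<longleftrightarrow> x \<in> ExoMap m ` Exo S"
        and endo: "\<And>x. x \<in> Endo X \<Longrightarrow> EndoMap \<psi> x = t \<longleftrightarrow> x \<in> EndoMap m ` Endo S"
        unfolding pb_iff[OF \<psi>] by blast+
      show "\<psi> = \<phi>"
      proof (rule Hom_TCM_eqI[OF \<psi> \<phi>])
        show "EndoMap \<psi> x = EndoMap \<phi> x" if "x \<in> Endo X" for x
          using endo[OF that] Hom_TCM_D(7)[OF \<psi> that] that by (auto simp: \<phi>_def)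
        \<comment> \<open>The pullback condition only decides whether the value is \<open>t\<close>.
          The choice between \<open>e\<close> and \<open>f\<close> is settled by the mechanism of
          \<open>\<Omega>\<close>, which sends them to different endogenous values.\<close>
        show "ExoMap \<psi> x = ExoMap \<phi> x" if x: "x \<in> Exo X" for x
        proof -
          have "ExoMap \<psi> x \<in> {f, e, t}"
            using Hom_TCM_D(6)[OF \<psi> x] by simp
          moreover from this have "EndoMap \<psi> (Mech X x) = (if ExoMap \<psi> x = f then f else t)"
            using Hom_TCM_D(8)[OF \<psi> x] by simp
          ultimately show ?thesis
            using exo[OF x] endo[OF is_tcmD(3)[OF X x]] x unfolding \<phi>_def
            by (auto split: if_splits)
        qed
      qed
    qed
  qed
  then have "is_subobject_classifier TCM \<Omega> (exo_point t) tru"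
    unfolding is_subobject_classifier_def using \<Omega> tru exo_point_terminal[OF u] by simp
  then show ?thesis
    unfolding has_subobject_classifier_def by blast
qed


theorem theorem2:
  assumes "universe TYPE('u)"
  shows "elementary_topos TYPE('u) (TCM :: ('u tcm, 'u tcm_arrow) cat)"
  unfolding elementary_topos_def
  using category_TCM TCM_has_small_limits[OF assms] TCM_has_small_colimits[OF assms]
    TCM_has_exponentials[OF assms] TCM_has_subobject_classifier[OF assms] by blast

end
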